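(* Let $R$ be an integral domain. The following conditions are equivalent: (i) $R$ is integrally closed and $w$-stable; (ii) $R$ is a $w$-stable P$v$MD; (iii) $R$ is a strongly discrete P$v$MD with $t$-finite character; (iv) $R$ is a generalized Krull domain with $t$-finite character; (v) $R$ is a $w$-stable generalized Krull domain; (vi) $R$ is a P$v$MD with $t$-finite character and each $t$-prime ideal of $R$ is $w$-stable; (vii) $R$ is $w$-stable and each $t$-maximal ideal of $R$ is $t$-invertible.
   Context: $R$ is an integral domain with quotient field $K\neq R$. For nonzero $R$-submodules $A,B$ of $K$, $(A:B)=\{x\in K: xB\subseteq A\}$; $E(I)=(I:I)$. For a nonzero fractional ideal $I$, $I_v=(R:(R:I))$, $I_t=\bigcup\{J_v: J\subseteq I\text{ nonzero finitely generated}\}$ ($I$ a $t$-ideal if $I=I_t$); $t$-primes are prime $t$-ideals; $t\text{-Max}(R)$ is the set of ideals maximal among proper $t$-ideals. $I$ is $t$-invertible if $(I(R:I))_t=R$. For a nonzero $R$-submodule $E$ of $K$, $E_w=\bigcap_{M\in t\text{-Max}(R)}ER_M$; $I$ is a $w$-ideal if $I=I_w$. A $w$-ideal $I$ is $w$-stable if $(I(E(I):I))_w=E(I)$; $R$ is $w$-stable if every $w$-ideal is $w$-stable. $R$ has $t$-finite character if each nonzero element lies in only finitely many $t$-maximal ideals. $R$ is a P$v$MD if $R_M$ is a valuation domain for each $M\in t\text{-Max}(R)$; a P$v$MD is strongly discrete if $(P^2)_t\neq P$ for each $t$-prime $P$. A generalized Krull domain is a strongly discrete P$v$MD satisfying the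 ascending chain condition on radical $t$-ideals. *)

theory Defs
  imports Main
begin

text \<open>An integral domain R is represented as a subring of a field 'a whose
  quotient field is all of 'a (K = UNIV).\<close>

definition is_subring :: "'a::field set \<Rightarrow> bool" where
  "is_subring R \<longleftrightarrow> 0 \<in> R \<and> 1 \<in> R \<and>
     (\<forall>x\<in>R. \<forall>y\<in>R. x + y \<in> R \<and> x * y \<in> R \<and> - x \<in> R)"

definition quotient_field_is_univ :: "'a::field set \<Rightarrow> bool" where
  "quotient_field_is_univ R \<longleftrightarrow> (\<forall>x. \<exists>a\<in>R. \<exists>b\<in>R. b \<noteq> 0 \<and> x = a / b)"

definition submod :: "'a::field set \<Rightarrow> 'a set \<Rightarrow> bool" where
  "submod R A \<longleftrightarrow> 0 \<in> A \<and> (\<forall>x\<in>A. \<forall>y\<in>A. x + y \<in> A) \<and> (\<forall>r\<in>R. \<forall>x\<in>A. r * x \<in> A)"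

definition nz_submod :: "'a::field set \<Rightarrow> 'a set \<Rightarrow> bool" where
  "nz_submod R A \<longleftrightarrow> submod R A \<and> A \<noteq> {0}"

definition frac_ideal :: "'a::field set \<Rightarrow> 'a set \<Rightarrow> bool" where
  "frac_ideal R I \<longleftrightarrow> nz_submod R I \<and> (\<exists>d\<in>R. d \<noteq> 0 \<and> (\<forall>x\<in>I. d * x \<in> R))"

definition r_ideal :: "'a::field set \<Rightarrow> 'a set \<Rightarrow> bool" where
  "r_ideal R I \<longleftrightarrow> submod R I \<and> I \<subseteq> R"

definition colon :: "'a::field set \<Rightarrow> 'a set \<Rightarrow> 'a set" where
  "colon A B = {x. \<forall>b\<in>B. x * b \<in> A}"

definition Eend :: "'a::field set \<Rightarrow> 'a set" where
  "Eend I = colon I I"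

definition smod_prod :: "'a::field set \<Rightarrow> 'a set \<Rightarrow> 'a set" where
  "smod_prod A B = {\<Sum>i<n. a i * b i | (n::nat) a b. \<forall>i<n. a i \<in> A \<and> b i \<in> B}"

definition rspan :: "'a::field set \<Rightarrow> 'a set \<Rightarrow> 'a set" where
  "rspan R S = {\<Sum>s\<in>S. f s * s | f. \<forall>s\<in>S. f s \<in> R}"

definition fin_gen :: "'a::field set \<Rightarrow> 'a set \<Rightarrow> bool" where
  "fin_gen R J \<longleftrightarrow> (\<exists>S. finite S \<and> J = rspan R S)"

definition v_op :: "'a::field set \<Rightarrow> 'a set \<Rightarrow> 'a set" where
  "v_op R I = colon R (colon R I)"

definition t_op :: "'a::field set \<Rightarrow> 'a set \<Rightarrow> 'a set" where
  "t_op R I = \<Union>{v_op R J | J. J \<subseteq> I \<and> fin_gen R J \<and> J \<noteq> {0}}"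

definition t_ideal :: "'a::field set \<Rightarrow> 'a set \<Rightarrow> bool" where
  "t_ideal R I \<longleftrightarrow> frac_ideal R I \<and> t_op R I = I"

definition prime_ideal :: "'a::field set \<Rightarrow> 'a set \<Rightarrow> bool" where
  "prime_ideal R P \<longleftrightarrow> r_ideal R P \<and> P \<noteq> R \<and>
     (\<forall>x\<in>R. \<forall>y\<in>R. x * y \<in> P \<longrightarrow> x \<in> P \<or> y \<in> P)"

definition t_prime :: "'a::field set \<Rightarrow> 'a set \<Rightarrow> bool" where
  "t_prime R P \<longleftrightarrow> prime_ideal R P \<and> t_ideal R P"

definition t_max :: "'a::field set \<Rightarrow> 'a set \<Rightarrow> bool" where
  "t_max R M \<longleftrightarrow> M \<subseteq> R \<and> t_ideal R M \<and> M \<noteq> R \<and>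
     (\<forall>N. N \<subseteq> R \<and> t_ideal R N \<and> N \<noteq> R \<and> M \<subseteq> N \<longrightarrow> N = M)"

definition t_invertible :: "'a::field set \<Rightarrow> 'a set \<Rightarrow> bool" where
  "t_invertible R I \<longleftrightarrow> t_op R (smod_prod I (colon R I)) = R"

definition localize :: "'a::field set \<Rightarrow> 'a set \<Rightarrow> 'a set \<Rightarrow> 'a set" where
  "localize R M E = {e / s | e s. e \<in> E \<and> s \<in> R \<and> s \<notin> M}"

definition w_op :: "'a::field set \<Rightarrow> 'a set \<Rightarrow> 'a set" where
  "w_op R E = \<Inter>{localize R M E | M. t_max R M}"

definition w_ideal :: "'a::field set \<Rightarrow> 'a set \<Rightarrow> bool" where
  "w_ideal R I \<longleftrightarrow> nz_submod R I \<and> w_op R I = I"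

definition w_stable_ideal :: "'a::field set \<Rightarrow> 'a set \<Rightarrow> bool" where
  "w_stable_ideal R I \<longleftrightarrow> w_op R (smod_prod I (colon (Eend I) I)) = Eend I"

definition w_stable_domain :: "'a::field set \<Rightarrow> bool" where
  "w_stable_domain R \<longleftrightarrow> (\<forall>I. I \<subseteq> R \<and> w_ideal R I \<longrightarrow> w_stable_ideal R I)"

definition integrally_closed :: "'a::field set \<Rightarrow> bool" where
  "integrally_closed R \<longleftrightarrow> (\<forall>x. (\<exists>n>0. \<exists>c. (\<forall>i<n. c i \<in> R) \<and>
       x ^ n + (\<Sum>i<n. c i * x ^ i) = 0) \<longrightarrow> x \<in> R)"

definition valuation_dom :: "'a::field set \<Rightarrow> bool" where
  "valuation_dom V \<longleftrightarrow> (\<forall>x. x \<noteq> 0 \<longrightarrow> x \<in> V \<or> inverse x \<in> V)"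

definition PvMD :: "'a::field set \<Rightarrow> bool" where
  "PvMD R \<longleftrightarrow> (\<forall>M. t_max R M \<longrightarrow> valuation_dom (localize R M R))"

definition t_finite_char :: "'a::field set \<Rightarrow> bool" where
  "t_finite_char R \<longleftrightarrow> (\<forall>x\<in>R. x \<noteq> 0 \<longrightarrow> finite {M. t_max R M \<and> x \<in> M})"

definition strongly_discrete_PvMD :: "'a::field set \<Rightarrow> bool" where
  "strongly_discrete_PvMD R \<longleftrightarrow> PvMD R \<and> (\<forall>P. t_prime R P \<longrightarrow> t_op R (smod_prod P P) \<noteq> P)"

definition radical_ideal :: "'a::field set \<Rightarrow> 'a set \<Rightarrow> bool" where
  "radical_ideal R I \<longleftrightarrow> I = {x\<in>R. \<exists>n. x ^ n \<in> I}"

definition acc_radical_t :: "'a::field set \<Rightarrow> bool" where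
  "acc_radical_t R \<longleftrightarrow> (\<forall>f :: nat \<Rightarrow> 'a set.
     (\<forall>n. f n \<subseteq> R \<and> t_ideal R (f n) \<and> radical_ideal R (f n)) \<and> (\<forall>n. f n \<subseteq> f (Suc n))
       \<longrightarrow> (\<exists>N. \<forall>n\<ge>N. f n = f N))"

definition gen_Krull :: "'a::field set \<Rightarrow> bool" where
  "gen_Krull R \<longleftrightarrow> strongly_discrete_PvMD R \<and> acc_radical_t R"

end

theory Submission
  imports Defs
begin

text \<open>Condition (iii) is the hub. For a PvMD the t- and w-operations agree, and stability of I can be
  tested locally at the t-maximal ideals M.

  If R is a w-stable PvMD, no t-prime is t-idempotent and every t-maximal ideal M has E(M) = R, so it
  is t-invertible. The sum of the (R : M) over the t-maximal M containing a nonzero x is then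
  w-locally principal, hence t-invertible and t-finite, which leaves only finitely many M.

  Conversely, in a strongly discrete PvMD each localization of an ideal I is principal over its
  endomorphism ring; by finite t-character, finitely many elements of I suffice to generate it
  locally everywhere, and the inverse of the ideal they generate lies in (E(I) : I).

  An integrally closed w-stable domain is a PvMD because two-generated ideals have endomorphism
  ring R. If instead the t-maximal ideals are t-invertible, the localizations are stable local
  domains with principal maximal ideal, and these are valuation domains.\<close>

section \<open>Submodules of a field\<close>

text \<open>Two devices carry the passage between local and global. A finite set S with (R : S) = R
  acts as a partition of unity: every nonzero integral ideal lying in no t-maximal ideal contains
  one, no t-maximal ideal contains S, and an element of K that S multiplies into R is in R.
  Conversely, w-stability of I supplies for each t-maximal M an element of I (E(I) : I) outside M,
  and the arguments work with that element instead of the w-closure. A t-idempotent t-prime P cannot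
  be w-stable, because P = (P P)_t traps P (E(P) : P) inside the localization of P at any t-maximal
  ideal above P. Failure of idempotence is used through one element q of a nonzero prime Q of R_M
  that is not a product of two elements of Q. It yields both the local generators over the
  endomorphism rings and the local stationarity of chains of radical t-ideals. Its place is taken by
  a descent through primes Q with Q R_Q = Q and R/Q a valuation domain.\<close>

lemma submod_zero: "submod R A \<Longrightarrow> 0 \<in> A"
  by (simp add: submod_def)

lemma submod_add: "submod R A \<Longrightarrow> x \<in> A \<Longrightarrow> y \<in> A \<Longrightarrow> x + y \<in> A"
  by (simp add: submod_def)

lemma submod_smult: "submod R A \<Longrightarrow> r \<in> R \<Longrightarrow> x \<in> A \<Longrightarrow> r * x \<in> A"
  by (simp add: submod_def)

lemma submodI:
  assumes "0 \<in> A" "\<And>x y. x \<in> A \<Longrightarrow> y \<in> A \<Longrightarrow> x + y \<in> A"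
    "\<And>r x. r \<in> R \<Longrightarrow> x \<in> A \<Longrightarrow> r * x \<in> A"
  shows "submod R A"
  using assms by (simp add: submod_def)

lemma submod_sum:
  assumes "submod R A" "\<And>i. i \<in> S \<Longrightarrow> f i \<in> A"
  shows "(\<Sum>i\<in>S. f i) \<in> A"
  using assms(2)
  by (induction S rule: infinite_finite_induct)
    (auto intro: submod_zero[OF assms(1)] submod_add[OF assms(1)])

lemma nz_submod_submod: "nz_submod R A \<Longrightarrow> submod R A"
  by (simp add: nz_submod_def)

lemma nz_submodE:
  assumes "nz_submod R A" obtains x where "x \<in> A" "x \<noteq> 0"
  using assms submod_zero[of R A] unfolding nz_submod_def by blast

lemma nz_submodI: "submod R A \<Longrightarrow> x \<in> A \<Longrightarrow> x \<noteq> 0 \<Longrightarrow> nz_submod R A"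
  by (auto simp: nz_submod_def)

lemma colonI: "(\<And>b. b \<in> B \<Longrightarrow> x * b \<in> A) \<Longrightarrow> x \<in> colon A B"
  by (simp add: colon_def)

lemma colonD: "x \<in> colon A B \<Longrightarrow> b \<in> B \<Longrightarrow> x * b \<in> A"
  by (simp add: colon_def)

lemma EendI: "(\<And>b. b \<in> A \<Longrightarrow> x * b \<in> A) \<Longrightarrow> x \<in> Eend A"
  by (simp add: Eend_def colon_def)

lemma EendD: "x \<in> Eend A \<Longrightarrow> b \<in> A \<Longrightarrow> x * b \<in> A"
  by (simp add: Eend_def colon_def)

lemma one_Eend: "1 \<in> Eend A"
  by (simp add: Eend_def colon_def)

lemma Eend_mult: "x \<in> Eend A \<Longrightarrow> y \<in> Eend A \<Longrightarrow> x * y \<in> Eend A"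
  by (simp add: Eend_def colon_def mult.assoc)

lemma submod_colon:
  assumes "submod R A" shows "submod R (colon A B)"
  using submod_zero[OF assms] submod_add[OF assms] submod_smult[OF assms]
  by (intro submodI) (auto simp: colon_def algebra_simps)

lemma submod_Eend: "submod R A \<Longrightarrow> submod R (Eend A)"
  unfolding Eend_def by (rule submod_colon)

lemma ring_subset_Eend: "submod R A \<Longrightarrow> R \<subseteq> Eend A"
  by (auto intro: EendI submod_smult)

lemma smod_prod_mult: "a \<in> A \<Longrightarrow> b \<in> B \<Longrightarrow> a * b \<in> smod_prod A B"
  unfolding smod_prod_def
  by (rule CollectI, rule exI[of _ "1::nat"], rule exI[of _ "\<lambda>_. a"], rule exI[of _ "\<lambda>_. b"]) simp

lemma smod_prod_zero: "0 \<in> smod_prod A B"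
  unfolding smod_prod_def
  by (rule CollectI, rule exI[of _ "0::nat"]) simp

lemma smod_prod_add:
  assumes "x \<in> smod_prod A B" "y \<in> smod_prod A B"
  shows "x + y \<in> smod_prod A B"
proof -
  obtain n :: nat and a b where x: "x = (\<Sum>i<n. a i * b i)" and ab: "\<forall>i<n. a i \<in> A \<and> b i \<in> B"
    using assms(1) unfolding smod_prod_def by blast
  obtain m :: nat and c d where y: "y = (\<Sum>i<m. c i * d i)" and cd: "\<forall>i<m. c i \<in> A \<and> d i \<in> B"
    using assms(2) unfolding smod_prod_def by blast
  define a' where "a' i = (if i < n then a i else c (i - n))" for i
  define b' where "b' i = (if i < n then b i else d (i - n))" for i
  have "(\<Sum>i<n+m. a' i * b' i) = (\<Sum>i<n. a' i * b' i) + (\<Sum>i<m. a' (n + i) * b' (n + i))"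
    by (induction m) (simp_all add: add.assoc)
  also have "\<dots> = x + y"
    by (simp add: x y a'_def b'_def)
  finally have "x + y = (\<Sum>i<n+m. a' i * b' i)" ..
  moreover have "\<forall>i<n+m. a' i \<in> A \<and> b' i \<in> B"
    using ab cd by (auto simp: a'_def b'_def)
  ultimately show ?thesis
    unfolding smod_prod_def by blast
qed

lemma smod_prod_induct [consumes 1, case_names zero add mult]:
  assumes "x \<in> smod_prod A B" and zero: "P 0"
    and add: "\<And>x y. P x \<Longrightarrow> P y \<Longrightarrow> P (x + y)"
    and mult: "\<And>a b. a \<in> A \<Longrightarrow> b \<in> B \<Longrightarrow> P (a * b)"
  shows "P x"
proof -
  obtain n :: nat and a b where x: "x = (\<Sum>i<n. a i * b i)" and ab: "\<forall>i<n. a i \<in> A \<and> b i \<in> B"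
    using assms(1) unfolding smod_prod_def by blast
  have "k \<le> n \<Longrightarrow> P (\<Sum>i<k. a i * b i)" for k
    by (induction k) (auto intro!: zero add mult simp: ab)
  then show ?thesis using x by blast
qed

lemma smod_prod_subset:
  assumes "submod R C" "\<And>a b. a \<in> A \<Longrightarrow> b \<in> B \<Longrightarrow> a * b \<in> C"
  shows "smod_prod A B \<subseteq> C"
proof
  fix x assume "x \<in> smod_prod A B"
  then show "x \<in> C"
    by (induction rule: smod_prod_induct)
      (auto intro: assms(2) submod_zero[OF assms(1)] submod_add[OF assms(1)])
qed

lemma smod_prod_notin:
  assumes "submod R C" "x \<in> smod_prod A B" "x \<notin> C"
  obtains a b where "a \<in> A" "b \<in> B" "a * b \<notin> C"
  using smod_prod_subset[OF assms(1), of A B] assms(2,3) by blast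

lemma submod_smod_prod:
  assumes "submod R A" shows "submod R (smod_prod A B)"
proof (rule submodI)
  fix r x assume r: "r \<in> R" and "x \<in> smod_prod A B"
  from this(2) show "r * x \<in> smod_prod A B"
  proof (induction rule: smod_prod_induct)
    case (mult a b)
    then show ?case
      using smod_prod_mult[of "r * a" A b B] submod_smult[OF assms r, of a]
      by (simp add: mult.assoc)
  qed (auto simp: distrib_left intro: smod_prod_zero smod_prod_add)
qed (auto intro: smod_prod_zero smod_prod_add)

text \<open>Scaling by d leaves the endomorphism ring alone and divides the colon by d. Stability
  thus passes from the multiple d I back to I, which is how statements about integral ideals reach
  fractional ones.\<close>

lemma smod_prod_scale:
  assumes "d \<noteq> 0"
  shows "smod_prod ((*) d ` I) (colon (Eend ((*) d ` I)) ((*) d ` I)) \<subseteq> smod_prod I (colon (Eend I) I)"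
proof
  have E: "Eend ((*) d ` I) = Eend I"
  proof (intro set_eqI iffI)
    fix y assume y: "y \<in> Eend ((*) d ` I)"
    show "y \<in> Eend I"
    proof (rule EendI)
      fix b assume "b \<in> I"
      then have "y * (d * b) \<in> (*) d ` I" by (intro EendD[OF y] imageI)
      then show "y * b \<in> I" using assms by (auto simp: mult.left_commute[of y])
    qed
  next
    fix y assume y: "y \<in> Eend I"
    show "y \<in> Eend ((*) d ` I)"
      using EendD[OF y] by (intro EendI) (auto simp: mult.left_commute)
  qed
  fix x assume "x \<in> smod_prod ((*) d ` I) (colon (Eend ((*) d ` I)) ((*) d ` I))"
  then show "x \<in> smod_prod I (colon (Eend I) I)"
  proof (induction rule: smod_prod_induct)
    case (mult a b)
    then obtain i where i: "a = d * i" "i \<in> I" by blast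
    have "d * b \<in> colon (Eend I) I"
    proof (rule colonI)
      fix k assume "k \<in> I"
      then have "b * (d * k) \<in> Eend I"
        using mult(2) unfolding E by (auto intro: colonD)
      then show "d * b * k \<in> Eend I" by (simp add: ac_simps)
    qed
    from smod_prod_mult[OF i(2) this] show ?case by (simp add: i ac_simps)
  qed (auto intro: smod_prod_zero smod_prod_add)
qed

section \<open>Subrings of a field and finite spans\<close>

locale field_subring =
  fixes R :: "'a::field set"
  assumes subring: "is_subring R"
begin

lemma zero_mem [simp]: "0 \<in> R" and one_mem [simp]: "1 \<in> R"
  using subring by (simp_all add: is_subring_def)

lemma add_mem: "x \<in> R \<Longrightarrow> y \<in> R \<Longrightarrow> x + y \<in> R"
  and mult_mem: "x \<in> R \<Longrightarrow> y \<in> R \<Longrightarrow> x * y \<in> R"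
  and neg_mem: "x \<in> R \<Longrightarrow> - x \<in> R"
  using subring by (simp_all add: is_subring_def)

lemma diff_mem: "x \<in> R \<Longrightarrow> y \<in> R \<Longrightarrow> x - y \<in> R"
  using add_mem[of x "- y"] neg_mem by simp

lemma power_mem: "x \<in> R \<Longrightarrow> x ^ n \<in> R"
  by (induction n) (auto intro: mult_mem)

lemma submod_self: "submod R R"
  by (rule submodI) (auto intro: add_mem mult_mem)

lemma submod_rspan: "submod R (rspan R S)"
proof (rule submodI)
  show "0 \<in> rspan R S"
    unfolding rspan_def by (auto intro!: exI[of _ "\<lambda>_. 0"])
next
  fix x y assume "x \<in> rspan R S" "y \<in> rspan R S"
  then obtain f g where "x = (\<Sum>s\<in>S. f s * s)" "\<forall>s\<in>S. f s \<in> R" "y = (\<Sum>s\<in>S. g s * s)" "\<forall>s\<in>S. g s \<in> R"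
    unfolding rspan_def by blast
  then show "x + y \<in> rspan R S"
    unfolding rspan_def
    by (auto intro!: exI[of _ "\<lambda>s. f s + g s"] add_mem simp: distrib_right sum.distrib)
next
  fix r x assume "r \<in> R" "x \<in> rspan R S"
  then obtain f where "x = (\<Sum>s\<in>S. f s * s)" "\<forall>s\<in>S. f s \<in> R" "r \<in> R"
    unfolding rspan_def by blast
  then show "r * x \<in> rspan R S"
    unfolding rspan_def
    by (auto intro!: exI[of _ "\<lambda>s. r * f s"] mult_mem simp: sum_distrib_left mult.assoc)
qed

lemma rspan_superset:
  assumes "finite S" shows "S \<subseteq> rspan R S"
proof
  fix x assume "x \<in> S"
  then have "x = (\<Sum>s\<in>S. (if s = x then 1 else 0) * s)"
    using assms by (simp add: if_distrib[of "\<lambda>a. a * _"] cong: if_cong)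
  then show "x \<in> rspan R S"
    unfolding rspan_def by (auto intro!: exI[of _ "\<lambda>s. if s = x then 1 else 0"])
qed

lemma rspan_least:
  assumes "submod R A" "S \<subseteq> A" shows "rspan R S \<subseteq> A"
  unfolding rspan_def using assms by (auto intro!: submod_sum[OF assms(1)] submod_smult[OF assms(1)])

lemma colon_rspan:
  assumes "finite S" shows "colon R (rspan R S) = colon R S"
proof (intro set_eqI iffI)
  fix x assume "x \<in> colon R (rspan R S)"
  then show "x \<in> colon R S"
    using rspan_superset[OF assms] by (auto simp: colon_def)
next
  fix x assume x: "x \<in> colon R S"
  have "submod R {y. x * y \<in> R}"
    by (rule submodI) (auto simp: distrib_left mult.left_commute intro: add_mem mult_mem)
  then have "rspan R S \<subseteq> {y. x * y \<in> R}"
    by (rule rspan_least) (use x in \<open>auto intro: colonD\<close>)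
  then show "x \<in> colon R (rspan R S)"
    by (auto intro: colonI)
qed

section \<open>The t-operation and the w-operation\<close>

text \<open>The colon (R : S) does not change when S is replaced by its span, so membership in a
  v-closure can be tested on finitely many generators. This elementwise form is the working
  definition of the t-closure.\<close>

lemma t_op_iff:
  assumes "submod R I"
  shows "x \<in> t_op R I \<longleftrightarrow> (\<exists>S. finite S \<and> S \<subseteq> I \<and> (\<exists>s\<in>S. s \<noteq> 0) \<and>
    (\<forall>y. (\<forall>s\<in>S. y * s \<in> R) \<longrightarrow> x * y \<in> R))" (is "_ \<longleftrightarrow> ?Q")
proof
  assume "x \<in> t_op R I"
  then obtain S where S: "finite S" "rspan R S \<subseteq> I" "rspan R S \<noteq> {0}" "x \<in> v_op R (rspan R S)"
    unfolding t_op_def fin_gen_def by blast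
  have "\<exists>s\<in>S. s \<noteq> 0"
  proof (rule ccontr)
    assume "\<not> ?thesis"
    then have "rspan R S \<subseteq> {0}"
      by (intro rspan_least submodI) auto
    then show False using S(3) submod_zero[OF submod_rspan] by blast
  qed
  moreover have "\<forall>y. (\<forall>s\<in>S. y * s \<in> R) \<longrightarrow> x * y \<in> R"
    using S(4) unfolding v_op_def colon_rspan[OF S(1)] by (auto simp: colon_def)
  ultimately show ?Q using S rspan_superset[OF S(1)] by blast
next
  assume ?Q
  then obtain S s where S: "finite S" "S \<subseteq> I" "s \<in> S" "s \<noteq> 0"
    "\<forall>y. (\<forall>s\<in>S. y * s \<in> R) \<longrightarrow> x * y \<in> R" by blast
  have "x \<in> v_op R (rspan R S)"
    unfolding v_op_def colon_rspan[OF S(1)] using S(5) by (auto simp: colon_def)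
  moreover have "rspan R S \<subseteq> I" using rspan_least[OF assms S(2)] .
  moreover have "rspan R S \<noteq> {0}" using rspan_superset[OF S(1)] S(3,4) by blast
  ultimately show "x \<in> t_op R I"
    unfolding t_op_def fin_gen_def using S(1) by blast
qed

lemma t_op_extensive:
  assumes "nz_submod R I" shows "I \<subseteq> t_op R I"
proof
  fix x assume x: "x \<in> I"
  obtain z where z: "z \<in> I" "z \<noteq> 0" using assms by (rule nz_submodE)
  show "x \<in> t_op R I"
    unfolding t_op_iff[OF nz_submod_submod[OF assms]]
    using x z by (intro exI[of _ "{x, z}"]) (auto simp: mult.commute)
qed

lemma t_op_mono:
  assumes "I \<subseteq> J" shows "t_op R I \<subseteq> t_op R J"
  unfolding t_op_def using order.trans[OF _ assms] by (intro Union_mono Collect_mono) blast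

lemma submod_t_op:
  assumes "nz_submod R I" shows "submod R (t_op R I)"
proof (rule submodI)
  note iff = t_op_iff[OF nz_submod_submod[OF assms]]
  show "0 \<in> t_op R I"
    using t_op_extensive[OF assms] submod_zero[OF nz_submod_submod[OF assms]] by blast
  fix x assume "x \<in> t_op R I"
  then obtain S where S: "finite S" "S \<subseteq> I" "\<exists>s\<in>S. s \<noteq> 0"
      "\<And>y. \<forall>s\<in>S. y * s \<in> R \<Longrightarrow> x * y \<in> R"
    unfolding iff by blast
  { fix y assume "y \<in> t_op R I"
    then obtain S' where S': "finite S'" "S' \<subseteq> I" "\<And>z. \<forall>s\<in>S'. z * s \<in> R \<Longrightarrow> y * z \<in> R"
      unfolding iff by blast
    show "x + y \<in> t_op R I"
      unfolding iff using S S'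
      by (intro exI[of _ "S \<union> S'"]) (auto simp: distrib_right intro!: add_mem) }
  { fix r assume "r \<in> R"
    then show "r * x \<in> t_op R I"
      unfolding iff using S
      by (intro exI[of _ S]) (auto simp: mult.assoc intro: mult_mem) }
qed

text \<open>Each of the finitely many elements of a witness inside the t-closure has its own finite
  witness in I; the union of these is again finite.\<close>

lemma t_op_idem:
  assumes "nz_submod R I" shows "t_op R (t_op R I) = t_op R I"
proof
  note iff = t_op_iff[OF nz_submod_submod[OF assms]]
  show "t_op R (t_op R I) \<subseteq> t_op R I"
  proof
    fix x assume "x \<in> t_op R (t_op R I)"
    then obtain S where S: "finite S" "S \<subseteq> t_op R I" "\<exists>s\<in>S. s \<noteq> 0"
      "\<And>y. \<forall>s\<in>S. y * s \<in> R \<Longrightarrow> x * y \<in> R"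
      unfolding t_op_iff[OF submod_t_op[OF assms]] by blast
    have "\<forall>s\<in>S. \<exists>T. finite T \<and> T \<subseteq> I \<and> (\<exists>t\<in>T. t \<noteq> 0) \<and> (\<forall>y. (\<forall>t\<in>T. y * t \<in> R) \<longrightarrow> s * y \<in> R)"
      using S(2) unfolding iff[symmetric] by blast
    then obtain T where T: "\<And>s. s \<in> S \<Longrightarrow> finite (T s) \<and> T s \<subseteq> I \<and> (\<exists>t\<in>T s. t \<noteq> 0) \<and>
        (\<forall>y. (\<forall>t\<in>T s. y * t \<in> R) \<longrightarrow> s * y \<in> R)" by metis
    show "x \<in> t_op R I"
      unfolding iff
    proof (intro exI[of _ "\<Union>(T ` S)"] conjI allI impI)
      show "finite (\<Union>(T ` S))" using S(1) T by blast
      show "\<Union>(T ` S) \<subseteq> I" using T by blast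
      obtain s where "s \<in> S" using S(3) by blast
      with T[of s] show "\<exists>s\<in>\<Union>(T ` S). s \<noteq> 0" by blast
      fix y assume "\<forall>s\<in>\<Union>(T ` S). y * s \<in> R"
      then have "\<forall>s\<in>S. y * s \<in> R" using T by (metis UN_I mult.commute)
      then show "x * y \<in> R" by (rule S(4))
    qed
  qed
  show "t_op R I \<subseteq> t_op R (t_op R I)"
    by (rule t_op_mono[OF t_op_extensive[OF assms]])
qed

lemma t_op_subset_ring:
  assumes "nz_submod R I" "I \<subseteq> R" shows "t_op R I \<subseteq> R"
proof
  fix x assume "x \<in> t_op R I"
  then obtain S where "S \<subseteq> I" "\<And>y. \<forall>s\<in>S. y * s \<in> R \<Longrightarrow> x * y \<in> R"
    unfolding t_op_iff[OF nz_submod_submod[OF assms(1)]] by blast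
  from this(2)[of 1] this(1) show "x \<in> R" using assms(2) by auto
qed

lemma integral_t_ideal_iff:
  assumes "I \<subseteq> R"
  shows "t_ideal R I \<longleftrightarrow> nz_submod R I \<and> t_op R I \<subseteq> I"
  using assms t_op_extensive[of I] unfolding t_ideal_def frac_ideal_def
  by (auto intro!: bexI[of _ 1])

lemma t_ideal_nz: "t_ideal R I \<Longrightarrow> nz_submod R I"
  by (simp add: t_ideal_def frac_ideal_def)

lemma t_ideal_finite:
  assumes "t_ideal R I" "finite S" "S \<subseteq> I" "s \<in> S" "s \<noteq> 0"
    and "\<And>y. \<forall>s\<in>S. y * s \<in> R \<Longrightarrow> x * y \<in> R"
  shows "x \<in> I"
proof -
  have "x \<in> t_op R I"
    unfolding t_op_iff[OF nz_submod_submod[OF t_ideal_nz[OF assms(1)]]] using assms(2-) by blast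
  then show ?thesis using assms(1) by (simp add: t_ideal_def)
qed

lemma t_max_ideal: "t_max R M \<Longrightarrow> t_ideal R M" "t_max R M \<Longrightarrow> M \<subseteq> R"
  by (simp_all add: t_max_def)

lemma t_max_submod: "t_max R M \<Longrightarrow> submod R M"
  by (rule nz_submod_submod[OF t_ideal_nz[OF t_max_ideal(1)]])

lemma one_notin_t_max:
  assumes "t_max R M" shows "1 \<notin> M"
proof
  assume "1 \<in> M"
  then have "R \<subseteq> M" using submod_smult[OF t_max_submod[OF assms], of _ 1] by auto
  then show False using assms by (auto simp: t_max_def)
qed

lemma t_max_incomparable:
  assumes "t_max R M" "t_max R M'" "M \<noteq> M'" shows "\<exists>r\<in>M. r \<notin> M'"
  using assms unfolding t_max_def by blast

text \<open>Membership in a t-closure has a finite witness, and a finite subset of the union of a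
  chain lies in one member. This is the hypothesis needed for Zorn's lemma.\<close>

lemma directed_Union_t_ideal:
  assumes "C \<noteq> {}" and C: "\<And>I. I \<in> C \<Longrightarrow> I \<subseteq> R \<and> t_ideal R I"
    and chain: "\<And>I J. I \<in> C \<Longrightarrow> J \<in> C \<Longrightarrow> I \<subseteq> J \<or> J \<subseteq> I"
  shows "t_ideal R (\<Union>C)"
proof -
  obtain I0 where I0: "I0 \<in> C" using assms(1) by blast
  have sub: "submod R I" if "I \<in> C" for I
    using C[OF that] by (auto intro: nz_submod_submod t_ideal_nz)
  have sm: "submod R (\<Union>C)"
  proof (rule submodI)
    show "0 \<in> \<Union>C" using I0 sub submod_zero by blast
    fix x y assume "x \<in> \<Union>C" "y \<in> \<Union>C"
    then obtain I where "I \<in> C" "x \<in> I" "y \<in> I" using chain by blast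
    then show "x + y \<in> \<Union>C" using submod_add[OF sub] by blast
  next
    fix r x assume "r \<in> R" "x \<in> \<Union>C"
    then show "r * x \<in> \<Union>C" using submod_smult[OF sub] by blast
  qed
  have fin: "\<exists>I\<in>C. S \<subseteq> I" if "finite S" "S \<subseteq> \<Union>C" for S
    using that
  proof (induction S)
    case (insert x S)
    then obtain I J where "I \<in> C" "S \<subseteq> I" "J \<in> C" "x \<in> J" by blast
    with chain[of I J] show ?case by blast
  qed (use I0 in blast)
  have "\<Union>C \<subseteq> R" using C by blast
  moreover have "nz_submod R (\<Union>C)"
  proof -
    obtain z where "z \<in> I0" "z \<noteq> 0" using C[OF I0] t_ideal_nz nz_submodE by metis
    with sm I0 show ?thesis by (intro nz_submodI) auto
  qed
  moreover have "t_op R (\<Union>C) \<subseteq> \<Union>C"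
  proof
    fix x assume "x \<in> t_op R (\<Union>C)"
    then obtain S s where S: "finite S" "S \<subseteq> \<Union>C" "s \<in> S" "s \<noteq> 0"
      "\<And>y. \<forall>s\<in>S. y * s \<in> R \<Longrightarrow> x * y \<in> R"
      unfolding t_op_iff[OF sm] by blast
    with fin obtain I where "I \<in> C" "S \<subseteq> I" by blast
    with C S show "x \<in> \<Union>C" by (blast intro: t_ideal_finite)
  qed
  ultimately show ?thesis by (simp add: integral_t_ideal_iff)
qed

lemma ex_t_max_superset:
  assumes nz: "nz_submod R I" and "I \<subseteq> R" "1 \<notin> t_op R I"
  shows "\<exists>M. t_max R M \<and> I \<subseteq> M"
proof -
  \<comment> \<open>Properness is stated as \<open>1 \<notin> N\<close> because this form passes
    directly to unions of chains. The start of the search is the t-closure of I itself.\<close>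
  define \<A> where "\<A> = {N. N \<subseteq> R \<and> t_ideal R N \<and> 1 \<notin> N \<and> I \<subseteq> N}"
  have sub: "t_op R I \<subseteq> R" using t_op_subset_ring assms by blast
  obtain z where "z \<in> I" "z \<noteq> 0" using nz by (rule nz_submodE)
  then have "nz_submod R (t_op R I)"
    using t_op_extensive[OF nz] by (intro nz_submodI[OF submod_t_op[OF nz]]) auto
  then have "t_op R I \<in> \<A>"
    using sub assms t_op_extensive[OF nz]
    by (auto simp: \<A>_def integral_t_ideal_iff t_op_idem[OF nz])
  then have "\<exists>M\<in>\<A>. \<forall>X\<in>\<A>. M \<subseteq> X \<longrightarrow> X = M"
  proof (intro subset_Zorn_nonempty)
    fix C assume C: "C \<noteq> {}" "subset.chain \<A> C"
    then have "t_ideal R (\<Union>C)"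
      by (intro directed_Union_t_ideal) (auto simp: subset_chain_def \<A>_def)
    with C show "\<Union>C \<in> \<A>"
      by (auto simp: subset_chain_def \<A>_def)
  qed auto
  then obtain M where M: "M \<in> \<A>" and max: "\<And>X. X \<in> \<A> \<Longrightarrow> M \<subseteq> X \<Longrightarrow> X = M" by blast
  have "t_max R M"
    unfolding t_max_def
  proof (intro conjI allI impI)
    fix N assume N: "N \<subseteq> R \<and> t_ideal R N \<and> N \<noteq> R \<and> M \<subseteq> N"
    then have "1 \<notin> N"
      using submod_smult[OF nz_submod_submod[OF t_ideal_nz], of N _ 1] by auto
    with N M show "N = M" by (intro max) (auto simp: \<A>_def)
  qed (use M one_mem in \<open>auto simp: \<A>_def\<close>)
  then show ?thesis using M by (auto simp: \<A>_def)
qed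

text \<open>Here 1 lies in the t-closure of I, for otherwise some t-maximal ideal would contain I.
  The finite witness S of this membership satisfies (R : S) = R.\<close>

lemma t_unit_finite:
  assumes "nz_submod R I" "I \<subseteq> R" "\<And>M. t_max R M \<Longrightarrow> \<exists>s\<in>I. s \<notin> M"
  obtains S where "finite S" "S \<subseteq> I" "\<exists>s\<in>S. s \<noteq> 0" "\<And>y. \<forall>s\<in>S. y * s \<in> R \<Longrightarrow> y \<in> R"
proof -
  have "1 \<in> t_op R I" using ex_t_max_superset[OF assms(1,2)] assms(3) by blast
  then show ?thesis
    unfolding t_op_iff[OF nz_submod_submod[OF assms(1)]] using that by auto
qed

lemma t_unit_not_subset:
  assumes "t_max R M" "finite S" "\<exists>s\<in>S. s \<noteq> 0" "\<And>y. \<forall>s\<in>S. y * s \<in> R \<Longrightarrow> y \<in> R"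
  shows "\<exists>s\<in>S. s \<notin> M"
proof (rule ccontr)
  assume neg: "\<not> ?thesis"
  obtain s where "s \<in> S" "s \<noteq> 0" using assms(3) by blast
  then have "1 \<in> M"
    using assms(4) neg by (intro t_ideal_finite[OF t_max_ideal(1)[OF assms(1)] assms(2)]) auto
  then show False using one_notin_t_max[OF assms(1)] by blast
qed

text \<open>If a and b are outside M but a b is in M, the ideal of all x with x b in M contains M
  and a. Were 1 in its t-closure, multiplying the finite witness by b would put b into M. So that
  ideal lies in a t-maximal ideal, which is M by maximality, and then a is in M.\<close>

lemma t_max_prime:
  assumes M: "t_max R M" shows "prime_ideal R M"
  unfolding prime_ideal_def
proof (intro conjI ballI impI)
  note sM = t_max_submod[OF M]
  show "r_ideal R M" using sM t_max_ideal(2)[OF M] by (simp add: r_ideal_def)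
  show "M \<noteq> R" using one_notin_t_max[OF M] one_mem by blast
  fix a b assume ab: "a \<in> R" "b \<in> R" "a * b \<in> M"
  show "a \<in> M \<or> b \<in> M"
  proof (rule ccontr)
    assume "\<not> (a \<in> M \<or> b \<in> M)"
    then have na: "a \<notin> M" and nb: "b \<notin> M" by auto
    define I where "I = {x \<in> R. x * b \<in> M}"
    have smI: "submod R I"
      unfolding I_def using submod_zero[OF sM] submod_add[OF sM] submod_smult[OF sM]
      by (intro submodI) (auto simp: distrib_right mult.assoc intro: add_mem mult_mem)
    have MI: "M \<subseteq> I"
      using t_max_ideal(2)[OF M] submod_smult[OF sM, of b] ab by (auto simp: I_def mult.commute)
    obtain z where z: "z \<in> M" "z \<noteq> 0"
      using t_ideal_nz[OF t_max_ideal(1)[OF M]] by (rule nz_submodE)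
    have nzI: "nz_submod R I" using smI MI z by (blast intro: nz_submodI)
    have "1 \<notin> t_op R I"
    proof
      assume "1 \<in> t_op R I"
      then obtain S s where S: "finite S" "S \<subseteq> I" "s \<in> S" "s \<noteq> 0" "\<And>y. \<forall>s\<in>S. y * s \<in> R \<Longrightarrow> y \<in> R"
        unfolding t_op_iff[OF smI] by auto
      have b0: "b \<noteq> 0" using nb submod_zero[OF sM] by auto
      have "b \<in> M"
      proof (rule t_ideal_finite[OF t_max_ideal(1)[OF M], of "(\<lambda>s. s * b) ` S" "s * b"])
        fix y assume "\<forall>t\<in>(\<lambda>s. s * b) ` S. y * t \<in> R"
        then show "b * y \<in> R" by (intro S(5)) (auto simp: ac_simps)
      qed (use S b0 in \<open>auto simp: I_def\<close>)
      then show False using nb by blast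
    qed
    then obtain N where N: "t_max R N" "I \<subseteq> N"
      using ex_t_max_superset[OF nzI] by (auto simp: I_def)
    have "N = M"
      using M N MI by (auto simp: t_max_def)
    moreover have "a \<in> I" using ab by (simp add: I_def)
    ultimately show False using N na by blast
  qed
qed

section \<open>Localization at a prime ideal\<close>

lemma prime_complement:
  assumes "prime_ideal R P"
  shows "1 \<in> R - P" "s \<in> R - P \<Longrightarrow> t \<in> R - P \<Longrightarrow> s * t \<in> R - P" "s \<in> R - P \<Longrightarrow> s \<noteq> 0"
proof -
  have P: "submod R P" "P \<subseteq> R" "P \<noteq> R" using assms by (auto simp: prime_ideal_def r_ideal_def)
  have "1 \<notin> P"
  proof
    assume "1 \<in> P"
    then have "R \<subseteq> P" using submod_smult[OF P(1), of _ 1] by auto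
    then show False using P by auto
  qed
  then show "1 \<in> R - P" by simp
  show "s \<in> R - P \<Longrightarrow> t \<in> R - P \<Longrightarrow> s * t \<in> R - P"
    using assms mult_mem by (auto simp: prime_ideal_def)
  show "s \<in> R - P \<Longrightarrow> s \<noteq> 0" using submod_zero[OF P(1)] by auto
qed

lemma mem_localize:
  assumes "prime_ideal R P"
  shows "y \<in> localize R P E \<longleftrightarrow> (\<exists>s\<in>R - P. s * y \<in> E)"
proof
  assume "y \<in> localize R P E"
  then obtain e s where "y = e / s" "e \<in> E" "s \<in> R - P" by (auto simp: localize_def)
  then show "\<exists>s\<in>R - P. s * y \<in> E"
    using prime_complement(3)[OF assms, of s] by (intro bexI[of _ s]) auto
next
  assume "\<exists>s\<in>R - P. s * y \<in> E"
  then obtain s where s: "s \<in> R - P" "s * y \<in> E" by blast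
  then have "y = (s * y) / s" using prime_complement(3)[OF assms, of s] by simp
  then show "y \<in> localize R P E" using s unfolding localize_def by blast
qed

lemmas t_max_complement = prime_complement[OF t_max_prime]
lemmas mem_localize_t_max = mem_localize[OF t_max_prime]

lemma localizeI: "t_max R M \<Longrightarrow> s \<in> R - M \<Longrightarrow> s * y \<in> E \<Longrightarrow> y \<in> localize R M E"
  by (auto simp: mem_localize_t_max)

lemma localize_superset: "prime_ideal R P \<Longrightarrow> E \<subseteq> localize R P E"
  using prime_complement(1)[of P] by (auto simp: mem_localize intro!: bexI[of _ 1])

lemma inverse_mem_localize:
  assumes "prime_ideal R P" "s \<in> R - P" shows "inverse s \<in> localize R P R"
  using assms prime_complement(3)[OF assms] by (auto simp: mem_localize intro!: bexI[of _ s])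

lemma localize_smult:
  assumes "prime_ideal R P" "submod R E" "v \<in> localize R P R" "y \<in> localize R P E"
  shows "v * y \<in> localize R P E"
proof -
  obtain s t where s: "s \<in> R - P" "s * v \<in> R" and t: "t \<in> R - P" "t * y \<in> E"
    using assms by (auto simp: mem_localize)
  have "(s * v) * (t * y) \<in> E" using submod_smult[OF assms(2)] s t by blast
  then have "(s * t) * (v * y) \<in> E" by (simp add: ac_simps)
  then show ?thesis
    unfolding mem_localize[OF assms(1)] using prime_complement(2)[OF assms(1) s(1) t(1)] by blast
qed

lemma localize_add:
  assumes "prime_ideal R P" "submod R E" "x \<in> localize R P E" "y \<in> localize R P E"
  shows "x + y \<in> localize R P E"
proof -
  obtain s t where s: "s \<in> R - P" "s * x \<in> E" and t: "t \<in> R - P" "t * y \<in> E"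
    using assms by (auto simp: mem_localize)
  have "t * (s * x) + s * (t * y) \<in> E"
    using submod_smult[OF assms(2)] submod_add[OF assms(2)] s t by blast
  then have "(s * t) * (x + y) \<in> E" by (simp add: algebra_simps)
  then show ?thesis
    unfolding mem_localize[OF assms(1)] using prime_complement(2)[OF assms(1) s(1) t(1)] by blast
qed

lemma submod_localize:
  assumes "prime_ideal R P" "submod R E" shows "submod (localize R P R) (localize R P E)"
  using localize_superset[OF assms(1), of E] submod_zero[OF assms(2)]
  by (intro submodI localize_add[OF assms] localize_smult[OF assms]) auto

lemma localize_div:
  assumes "prime_ideal R P" "submod R E" "s \<in> R - P" "s * y \<in> localize R P E"
  shows "y \<in> localize R P E"
  using localize_smult[OF assms(1,2) inverse_mem_localize[OF assms(1,3)] assms(4)]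
    prime_complement(3)[OF assms(1,3)] by (simp add: mult.assoc[symmetric])

lemma is_subring_localize:
  assumes "prime_ideal R P" shows "is_subring (localize R P R)"
proof -
  note L = localize_superset[OF assms, of R]
  have "- x \<in> localize R P R" if "x \<in> localize R P R" for x
    using localize_smult[OF assms submod_self, of "- 1" x] that L neg_mem[OF one_mem] by auto
  then show ?thesis
    unfolding is_subring_def using L
    by (auto intro: localize_add[OF assms submod_self] localize_smult[OF assms submod_self])
qed

section \<open>The w-operation\<close>

lemma mem_w_op: "x \<in> w_op R E \<longleftrightarrow> (\<forall>M. t_max R M \<longrightarrow> x \<in> localize R M E)"
  unfolding w_op_def by blast

lemma w_op_extensive: "E \<subseteq> w_op R E"
  using localize_superset[OF t_max_prime] by (simp add: mem_w_op subset_iff)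

lemma w_op_mono: "E \<subseteq> F \<Longrightarrow> w_op R E \<subseteq> w_op R F"
  by (fastforce simp: mem_w_op localize_def)

lemma submod_w_op:
  assumes "submod R E" shows "submod R (w_op R E)"
proof (rule submodI)
  show "0 \<in> w_op R E" using submod_zero[OF assms] w_op_extensive by blast
  fix x assume x: "x \<in> w_op R E"
  show "x + y \<in> w_op R E" if "y \<in> w_op R E" for y
    using x that by (simp add: mem_w_op localize_add[OF t_max_prime assms])
  show "r * x \<in> w_op R E" if "r \<in> R" for r
    using x that subsetD[OF localize_superset[OF t_max_prime], of _ r R]
    by (simp add: mem_w_op localize_smult[OF t_max_prime assms])
qed

lemma w_op_idem:
  assumes "submod R E" shows "w_op R (w_op R E) = w_op R E"
proof
  show "w_op R (w_op R E) \<subseteq> w_op R E"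
  proof
    fix x assume x: "x \<in> w_op R (w_op R E)"
    show "x \<in> w_op R E"
      unfolding mem_w_op
    proof (intro allI impI)
      fix M assume M: "t_max R M"
      then obtain s where "s \<in> R - M" "s * x \<in> w_op R E"
        using x by (auto simp: mem_w_op mem_localize_t_max)
      then show "x \<in> localize R M E"
        using M localize_div[OF t_max_prime assms] by (auto simp: mem_w_op)
    qed
  qed
qed (rule w_op_extensive)

end

section \<open>Stable local domains with principal maximal ideal\<close>

text \<open>Elements outside Q divide all of Q and are comparable with every element of R.
  Equivalently, Q is already an ideal of the localization W at Q, and R/Q is a valuation domain with
  quotient field W/Q.\<close>

definition divided_prime :: "'a::field set \<Rightarrow> 'a set \<Rightarrow> bool" where
  "divided_prime R Q \<longleftrightarrow> prime_ideal R Q \<and>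
     (\<forall>a\<in>R - Q. (\<forall>b\<in>R. b / a \<in> R \<or> a / b \<in> R) \<and> (\<forall>q\<in>Q. q / a \<in> R))"

text \<open>Stability of all fractional ideals without any w-closure, the form suited to the local
  rings R_M. Asking for 1 is enough, because the product is an ideal of E(I).\<close>

definition stable_ring :: "'a::field set \<Rightarrow> bool" where
  "stable_ring R \<longleftrightarrow> (\<forall>I d. nz_submod R I \<and> d \<noteq> 0 \<and> (\<forall>x\<in>I. d * x \<in> R) \<longrightarrow>
     1 \<in> smod_prod I (colon (Eend I) I))"

lemma stable_ringD:
  assumes "stable_ring R" "nz_submod R I" "d \<noteq> 0" "\<And>x. x \<in> I \<Longrightarrow> d * x \<in> R"
  shows "1 \<in> smod_prod I (colon (Eend I) I)"
  using assms unfolding stable_ring_def by blast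

context field_subring
begin

lemma prime_submod: "prime_ideal R Q \<Longrightarrow> submod R Q"
  by (simp add: prime_ideal_def r_ideal_def)

lemma prime_subset: "prime_ideal R Q \<Longrightarrow> Q \<subseteq> R"
  by (simp add: prime_ideal_def r_ideal_def)

text \<open>For a denominator s outside Q, the quotient q / s is in R by dividedness and then in Q
  by primality. Hence Q absorbs its localization.\<close>

lemma divided_prime_localize_mult:
  assumes "divided_prime R Q" "w \<in> localize R Q R" "q \<in> Q"
  shows "w * q \<in> Q"
proof -
  have Q: "prime_ideal R Q" using assms(1) by (simp add: divided_prime_def)
  obtain s where s: "s \<in> R - Q" "s * w \<in> R" using assms(2) mem_localize[OF Q] by blast
  have s0: "s \<noteq> 0" using prime_complement(3)[OF Q s(1)] .
  have "q / s \<in> R" using assms(1,3) s(1) by (simp add: divided_prime_def)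
  moreover have "s * (q / s) \<in> Q" using assms(3) s0 by simp
  ultimately have "q / s \<in> Q" using Q s(1) unfolding prime_ideal_def by blast
  then have "(s * w) * (q / s) \<in> Q" by (rule submod_smult[OF prime_submod[OF Q] s(2)])
  then show ?thesis using s0 by simp
qed

text \<open>Q is thus the maximal ideal of its localization: if s w were in Q, division by s would
  bring w into Q.\<close>

lemma divided_prime_localize_unit:
  assumes "divided_prime R Q" "w \<in> localize R Q R" "w \<notin> Q"
  shows "inverse w \<in> localize R Q R"
proof -
  have Q: "prime_ideal R Q" using assms(1) by (simp add: divided_prime_def)
  obtain s where s: "s \<in> R - Q" "s * w \<in> R" using assms(2) mem_localize[OF Q] by blast
  have s0: "s \<noteq> 0" using prime_complement(3)[OF Q s(1)] .
  have w0: "w \<noteq> 0" using assms(3) submod_zero[OF prime_submod[OF Q]] by auto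
  have "s * w \<notin> Q"
  proof
    assume "s * w \<in> Q"
    from divided_prime_localize_mult[OF assms(1) inverse_mem_localize[OF Q s(1)] this]
    show False using assms(3) s0 by (simp add: mult.assoc[symmetric])
  qed
  then show ?thesis
    unfolding mem_localize[OF Q] using s w0 by (intro bexI[of _ "s * w"]) (auto simp: mult.assoc)
qed

text \<open>Let W be the localization at Q. An x in E(Q) outside W makes I = W + R x a fractional
  ideal, since d carries both W and x into Q. The largest W-module inside I is only W, which forces
  (E(I) : I), and with it I (E(I) : I), into Q; but stability puts 1 there.\<close>

lemma stable_Eend_divided_prime:
  assumes stable: "stable_ring R"
    and m: "m \<in> R" "inverse m \<notin> R"
    and dQ: "divided_prime R Q" and mQ: "m \<notin> Q" and d: "d \<in> Q" "d \<noteq> 0"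
  shows "Eend Q \<subseteq> localize R Q R"
proof
  define W where "W = localize R Q R"
  have Q: "prime_ideal R Q" using dQ by (simp add: divided_prime_def)
  interpret W: field_subring W
    unfolding W_def by unfold_locales (rule is_subring_localize[OF Q])
  have RW: "R \<subseteq> W" unfolding W_def by (rule localize_superset[OF Q])
  have sQ: "submod R Q" by (rule prime_submod[OF Q])
  have QR: "Q \<subseteq> R" by (rule prime_subset[OF Q])
  have WQ: "w * q \<in> Q" if "w \<in> W" "q \<in> Q" for w q
    using divided_prime_localize_mult[OF dQ] that by (simp add: W_def)
  have unit: "inverse w \<in> W" if "w \<in> W" "w \<notin> Q" for w
    using divided_prime_localize_unit[OF dQ] that by (simp add: W_def)
  have Q0: "0 \<in> Q" using submod_zero[OF sQ] .
  have Q1: "1 \<notin> Q" using prime_complement(1)[OF Q] by simp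
  fix x assume xE: "x \<in> Eend Q"
  have "x \<in> W"
  proof (rule ccontr)
    assume xW: "x \<notin> W"
    have xQ: "x * q \<in> Q" if "q \<in> Q" for q using EendD[OF xE that] .
    \<comment> \<open>Elements of W outside Q are units of W, so an element of W that multiplies x
      into W must lie in Q.\<close>
    have cancel: "u \<in> Q" if "u \<in> W" "u * x \<in> W" for u
    proof (rule ccontr)
      assume "u \<notin> Q"
      then have "inverse u \<in> W" "u \<noteq> 0" using unit that Q0 by auto
      then have "inverse u * (u * x) \<in> W" using W.mult_mem that by blast
      then show False using \<open>u \<noteq> 0\<close> xW by (simp add: mult.assoc[symmetric])
    qed
    \<comment> \<open>W + R x is not stable: every element of (E(I) : I) must lie in Q.\<close>
    define I where "I = {w + v * x |w v. w \<in> W \<and> v \<in> R}"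
    have I: "w + v * x \<in> I" if "w \<in> W" "v \<in> R" for w v
      using that by (auto simp: I_def)
    have sI: "submod R I"
    proof (rule submodI)
      show "0 \<in> I" using I[of 0 0] by simp
      fix y z assume "y \<in> I" "z \<in> I"
      then obtain w v w' v' where "y = w + v * x" "z = w' + v' * x" "w \<in> W" "w' \<in> W" "v \<in> R" "v' \<in> R"
        by (auto simp: I_def)
      then show "y + z \<in> I" using I[of "w + w'" "v + v'"] by (simp add: algebra_simps add_mem W.add_mem)
    next
      fix r y assume r: "r \<in> R" and "y \<in> I"
      then obtain w v where "y = w + v * x" "w \<in> W" "v \<in> R" by (auto simp: I_def)
      then show "r * y \<in> I" using I[of "r * w" "r * v"] r RW
        by (simp add: algebra_simps mult_mem W.mult_mem subset_iff)
    qed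
    have WI: "W \<subseteq> I" using I[of _ 0] by auto
    have xI: "x \<in> I" using I[of 0 1] by auto
    have nzI: "nz_submod R I" using sI WI by (intro nz_submodI[of _ _ 1]) auto
    have "d * y \<in> R" if yI: "y \<in> I" for y
    proof -
      obtain w v where y: "y = w + v * x" "w \<in> W" "v \<in> R" using yI by (auto simp: I_def)
      have "w * d + v * (x * d) \<in> Q"
        using submod_add[OF sQ WQ[OF y(2) d(1)] submod_smult[OF sQ y(3) xQ[OF d(1)]]] .
      then show ?thesis using QR y(1) by (auto simp: algebra_simps)
    qed
    from stable_ringD[OF stable nzI d(2) this] have one: "1 \<in> smod_prod I (colon (Eend I) I)" .
    \<comment> \<open>If the coefficient v of y is outside Q, then m v is a unit of W. Comparing y
      with y / (m v), both written in W + R x, puts 1 - m v' into Q. Dividedness then makes m divide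
      it, so m would be a unit of R.\<close>
    have key: "y \<in> W" if y: "\<And>w. w \<in> W \<Longrightarrow> w * y \<in> I" for y
    proof -
      obtain w v where yv: "y = w + v * x" "w \<in> W" "v \<in> R"
        using y[of 1] by (auto simp: I_def)
      show ?thesis
      proof (cases "v \<in> Q")
        case True
        then have "x * v \<in> W" using xQ QR RW by blast
        then show ?thesis using W.add_mem yv by (simp add: mult.commute)
      next
        case False
        then have mv: "m * v \<in> R - Q" using prime_complement(2)[OF Q] m(1) mQ yv(3) by blast
        then have mv0: "m * v \<noteq> 0" using prime_complement(3)[OF Q] by blast
        obtain w' v' where w': "inverse (m * v) * y = w' + v' * x" "w' \<in> W" "v' \<in> R"
          using y[OF unit, of "m * v"] mv RW by (auto simp: I_def)
        have "y = (m * v) * (inverse (m * v) * y)" using mv0 by (simp add: field_simps)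
        also have "\<dots> = m * v * w' + m * v * v' * x" unfolding w'(1) by (simp add: algebra_simps)
        finally have "(v * (1 - m * v')) * x = m * v * w' - w"
          using yv(1) by (simp add: algebra_simps)
        moreover have "m * v * w' - w \<in> W" using m(1) w' yv(2,3) RW by (intro W.diff_mem W.mult_mem) auto
        moreover have r: "1 - m * v' \<in> R" using diff_mem mult_mem m(1) w'(3) by simp
        ultimately have "v * (1 - m * v') \<in> Q"
          using yv RW mult_mem by (intro cancel) auto
        then have "1 - m * v' \<in> Q" using False Q r yv(3) unfolding prime_ideal_def by blast
        then have "(1 - m * v') / m \<in> R" using dQ m(1) mQ by (simp add: divided_prime_def)
        then have "(1 - m * v') / m + v' \<in> R" using w'(3) by (rule add_mem)
        moreover have "m \<noteq> 0" using mQ Q0 by auto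
        ultimately show ?thesis using m(2) by (simp add: field_simps)
      qed
    qed
    \<comment> \<open>f sends W into E(I), so W f z stays in I for every z in I. By
      \<open>key\<close>, both f and f x are in W.\<close>
    have "f \<in> Q" if f: "f \<in> colon (Eend I) I" for f
    proof (rule cancel)
      have *: "w * (f * z) \<in> I" if "w \<in> W" "z \<in> I" for w z
        using EendD[OF colonD[OF f, of w] that(2)] that WI by (auto simp: ac_simps)
      show "f \<in> W" using *[of _ 1] subsetD[OF WI W.one_mem] by (intro key) auto
      show "f * x \<in> W" using * xI by (intro key) auto
    qed
    then have "smod_prod I (colon (Eend I) I) \<subseteq> Q"
    proof (intro smod_prod_subset[OF sQ])
      fix y f assume "y \<in> I" and f: "f \<in> colon (Eend I) I" and "\<And>f. f \<in> colon (Eend I) I \<Longrightarrow> f \<in> Q"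
      then have fQ: "f \<in> Q" by blast
      obtain w v where "y = w + v * x" "w \<in> W" "v \<in> R" using \<open>y \<in> I\<close> by (auto simp: I_def)
      then show "y * f \<in> Q"
        using submod_add[OF sQ WQ[of w f] submod_smult[OF sQ _ xQ, of v f]] fQ
        by (simp add: algebra_simps)
    qed
    then show False using one Q1 by blast
  qed
  then show "x \<in> localize R Q R" by (simp add: W_def)
qed

text \<open>If m is in Q, it divides every nonunit and so generates. Otherwise E(Q) lies in the
  localization W, and stability of Q yields p in Q and y with Q y inside W and p y outside Q. Then p
  y is a unit of W and q / p = (q y) / (p y) is in W.\<close>

lemma stable_divided_prime_principal:
  assumes stable: "stable_ring R"
    and m: "m \<in> R" "inverse m \<notin> R" "\<forall>x\<in>R. inverse x \<notin> R \<longrightarrow> x / m \<in> R"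
    and dQ: "divided_prime R Q" and d: "d \<in> Q" "d \<noteq> 0"
  shows "\<exists>p\<in>Q. p \<noteq> 0 \<and> (\<forall>q\<in>Q. q / p \<in> localize R Q R)"
proof -
  have Q: "prime_ideal R Q" using dQ by (simp add: divided_prime_def)
  have sQ: "submod R Q" by (rule prime_submod[OF Q])
  have QR: "Q \<subseteq> R" by (rule prime_subset[OF Q])
  have Q1: "1 \<notin> Q" using prime_complement(1)[OF Q] by simp
  have m0: "m \<noteq> 0" using m(2) by auto
  show ?thesis
  proof (cases "m \<in> Q")
    case True
    have "q / m \<in> localize R Q R" if q: "q \<in> Q" for q
    proof (cases "q = 0")
      case False
      have "inverse q \<notin> R" using submod_smult[OF sQ _ q, of "inverse q"] False Q1 by auto
      then show ?thesis using m(3) q QR localize_superset[OF Q, of R] by auto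
    qed (use localize_superset[OF Q, of R] in auto)
    then show ?thesis using True m0 by blast
  next
    case False
    note EW = stable_Eend_divided_prime[OF stable m(1,2) dQ False d]
    have "nz_submod R Q" using sQ d by (rule nz_submodI)
    then have "1 \<in> smod_prod Q (colon (Eend Q) Q)"
      by (rule stable_ringD[OF stable, of _ 1]) (use QR in auto)
    then obtain p y where py: "p \<in> Q" "y \<in> colon (Eend Q) Q" "p * y \<notin> Q"
      using smod_prod_notin[OF sQ _ Q1] by metis
    have yW: "q * y \<in> localize R Q R" if "q \<in> Q" for q
      using colonD[OF py(2) that] EW by (auto simp: mult.commute)
    have 0: "p \<noteq> 0" "y \<noteq> 0" using py(3) submod_zero[OF sQ] by auto
    have "q / p \<in> localize R Q R" if "q \<in> Q" for q
    proof -
      have "(q * y) * inverse (p * y) \<in> localize R Q R"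
        by (intro localize_smult[OF Q submod_self] yW that
            divided_prime_localize_unit[OF dQ] py(1,3))
      then show ?thesis using 0 by (simp add: field_simps)
    qed
    then show ?thesis using py(1) 0(1) by blast
  qed
qed

text \<open>With W the localization, Q = p W, and Q' is the intersection of all \<open>p ^ n\<close>
  W. Outside Q' every element of W is a power of p times a unit, so W/Q' is a discrete valuation
  ring placed on top of the valuation ring R/Q. Comparing exponents first and units second shows
  that Q' is divided; p separates it from Q.\<close>

lemma divided_prime_principal_next:
  assumes dQ: "divided_prime R Q" and p: "p \<in> Q" "p \<noteq> 0" "\<And>q. q \<in> Q \<Longrightarrow> q / p \<in> localize R Q R"
  defines "Q' \<equiv> {q. \<forall>n. q / p ^ n \<in> localize R Q R}"
  shows "divided_prime R Q'" "p \<notin> Q'"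
    "\<And>a. a \<in> localize R Q R \<Longrightarrow> a \<notin> Q' \<Longrightarrow> \<exists>k u. a = p ^ k * u \<and> u \<in> localize R Q R - Q"
proof -
  define W where "W = localize R Q R"
  have Q: "prime_ideal R Q" using dQ by (simp add: divided_prime_def)
  interpret W: field_subring W
    unfolding W_def by unfold_locales (rule is_subring_localize[OF Q])
  have RW: "R \<subseteq> W" unfolding W_def by (rule localize_superset[OF Q])
  have sQ: "submod R Q" by (rule prime_submod[OF Q])
  have QR: "Q \<subseteq> R" by (rule prime_subset[OF Q])
  have WQ: "w * q \<in> Q" if "w \<in> W" "q \<in> Q" for w q
    using divided_prime_localize_mult[OF dQ] that by (simp add: W_def)
  have unit: "inverse w \<in> W" if "w \<in> W - Q" for w
    using divided_prime_localize_unit[OF dQ] that by (simp add: W_def)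
  have Q0: "0 \<in> Q" using submod_zero[OF sQ] .
  have Q1: "1 \<notin> Q" using prime_complement(1)[OF Q] by simp
  have ip: "inverse p \<notin> W" using WQ[OF _ p(1), of "inverse p"] Q1 p(2) by auto
  have unit_mult: "u * v \<in> W - Q" if "u \<in> W - Q" "v \<in> W - Q" for u v
  proof -
    have "u \<noteq> 0" using that(1) Q0 by auto
    have "u * v \<notin> Q"
    proof
      assume "u * v \<in> Q"
      from WQ[OF unit[OF that(1)] this] show False using that \<open>u \<noteq> 0\<close> by (simp add: mult.assoc[symmetric])
    qed
    then show ?thesis using W.mult_mem that by auto
  qed
  have memQ': "q \<in> Q' \<longleftrightarrow> (\<forall>n. q / p ^ n \<in> W)" for q by (simp add: Q'_def W_def)
  have pW: "p ^ Suc k * w \<in> Q" if "w \<in> W" for k w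
  proof -
    have "p ^ k * w \<in> W" using that p(1) QR RW by (intro W.mult_mem W.power_mem) auto
    from WQ[OF this p(1)] show ?thesis by (simp add: ac_simps)
  qed
  show pQ': "p \<notin> Q'"
  proof
    assume "p \<in> Q'"
    then have "p / p ^ 2 \<in> W" unfolding memQ' by blast
    then show False using ip p(2) by (simp add: power2_eq_square inverse_eq_divide)
  qed
  have rep: "\<exists>k u. a = p ^ k * u \<and> u \<in> W - Q" if a: "a \<in> W" "a \<notin> Q'" for a
  proof -
    \<comment> \<open>The first exponent whose quotient leaves W; the exponent before it splits off
      a unit of W.\<close>
    define n where "n = (LEAST n. a / p ^ n \<notin> W)"
    have n: "a / p ^ n \<notin> W"
      unfolding n_def using a(2)[unfolded memQ'] LeastI_ex[of "\<lambda>n. a / p ^ n \<notin> W"] by blast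
    have "n \<noteq> 0" using a(1) n by (metis div_by_1 power_0)
    then obtain k where k: "n = Suc k" using not0_implies_Suc by blast
    have u: "a / p ^ k \<in> W" using not_less_Least[of k "\<lambda>n. a / p ^ n \<notin> W"] k by (simp add: n_def)
    have "a / p ^ k \<notin> Q"
    proof
      assume "a / p ^ k \<in> Q"
      from p(3)[OF this] show False using n k by (simp add: W_def ac_simps)
    qed
    then show ?thesis using u p(2) by (intro exI[of _ k] exI[of _ "a / p ^ k"]) simp
  qed
  then show "\<exists>k u. a = p ^ k * u \<and> u \<in> localize R Q R - Q" if "a \<in> localize R Q R" "a \<notin> Q'" for a
    using that by (simp add: W_def)
  have pow_notin: "p ^ k * u \<notin> Q'" if u: "u \<in> W - Q" for k u
  proof
    assume "p ^ k * u \<in> Q'"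
    then have "(p ^ k * u) / p ^ Suc k \<in> W" unfolding memQ' by blast
    then have "u / p \<in> W" using p(2) by simp
    then have "(u / p) * inverse u \<in> W" using unit[OF u] by (rule W.mult_mem)
    moreover have "u \<noteq> 0" using u Q0 by auto
    ultimately show False using ip by (simp add: field_simps inverse_eq_divide)
  qed
  have Q'Q: "Q' \<subseteq> Q"
  proof
    fix q assume "q \<in> Q'"
    then have "q / p ^ 1 \<in> W" unfolding memQ' by blast
    from WQ[OF this p(1)] show "q \<in> Q" using p(2) by simp
  qed
  have div: "p ^ l * v / (p ^ k * u) \<in> R" if "k < l" "v \<in> W" "u \<in> W - Q" for k l u v
  proof -
    obtain j where j: "l = k + Suc j" using less_imp_Suc_add[OF \<open>k < l\<close>] by auto
    have "p ^ l * v / (p ^ k * u) = p ^ Suc j * (v * inverse u)"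
      unfolding j power_add using p(2) by (simp add: divide_inverse)
    also have "\<dots> \<in> Q" using that unit by (intro pW W.mult_mem) auto
    finally show ?thesis using QR by blast
  qed
  show "divided_prime R Q'"
    unfolding divided_prime_def prime_ideal_def r_ideal_def
  proof (intro conjI ballI impI)
    show "submod R Q'"
    proof (rule submodI)
      show "0 \<in> Q'" by (simp add: memQ')
      fix x y assume "x \<in> Q'" "y \<in> Q'"
      then show "x + y \<in> Q'" by (simp add: memQ' add_divide_distrib W.add_mem)
    next
      fix r x assume "r \<in> R" "x \<in> Q'"
      then show "r * x \<in> Q'"
        using RW W.mult_mem unfolding memQ' times_divide_eq_right[symmetric] by blast
    qed
    show "Q' \<subseteq> R" using Q'Q QR by blast
    show "Q' \<noteq> R" using Q'Q Q1 one_mem by blast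
  next
    fix a b assume ab: "a \<in> R" "b \<in> R" "a * b \<in> Q'"
    show "a \<in> Q' \<or> b \<in> Q'"
    proof (rule ccontr)
      assume "\<not> (a \<in> Q' \<or> b \<in> Q')"
      then obtain k u l v where "a = p ^ k * u" "u \<in> W - Q" "b = p ^ l * v" "v \<in> W - Q"
        using rep ab RW by (metis subsetD)
      then show False
        using ab(3) pow_notin[OF unit_mult, of u v "k + l"] by (simp add: power_add ac_simps)
    qed
  next
    fix a b assume a: "a \<in> R - Q'" and b: "b \<in> R"
    obtain k u where u: "a = p ^ k * u" "u \<in> W - Q" using rep a RW by blast
    show "b / a \<in> R \<or> a / b \<in> R"
    proof (cases "b \<in> Q'")
      case True
      then have "b / p ^ Suc k \<in> W" unfolding memQ' by blast
      from div[OF _ this u(2), of k "Suc k"] show ?thesis using u p(2) by simp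
    next
      case False
      then obtain l v where v: "b = p ^ l * v" "v \<in> W - Q" using rep b RW by blast
      consider "k < l" | "l < k" | "k = l" by linarith
      then show ?thesis
      proof cases
        \<comment> \<open>With equal exponents only the units are left. A denominator s outside Q
          writes u / v as a quotient of elements of R, and dividedness of Q compares these.\<close>
        case 3
        have "u * inverse v \<in> W" using unit u v W.mult_mem by blast
        then obtain s where s: "s \<in> R - Q" "s * (u * inverse v) \<in> R"
          unfolding W_def mem_localize[OF Q] by blast
        have s0: "s \<noteq> 0" and v0: "v \<noteq> 0" using prime_complement(3)[OF Q s(1)] v Q0 by auto
        have "s * (u * inverse v) / s \<in> R \<or> s / (s * (u * inverse v)) \<in> R"
          using dQ s unfolding divided_prime_def by blast
        then show ?thesis using s0 v0 u v 3 p(2) by (auto simp: field_simps)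
      qed (use div u v in auto)
    qed
  next
    fix a q assume a: "a \<in> R - Q'" and q: "q \<in> Q'"
    obtain k u where u: "a = p ^ k * u" "u \<in> W - Q" using rep a RW by blast
    have "q / p ^ Suc k \<in> W" using q unfolding memQ' by blast
    from div[OF _ this u(2), of k "Suc k"] show "q / a \<in> R" using u p(2) by simp
  qed
qed

text \<open>If neither x nor its inverse lies in R, the divided primes containing the conductor of x
  form a chain whose least element Q is principal over its localization by stability. The
  intersection of the powers of Q is then a strictly smaller divided prime containing the
  conductor.\<close>

lemma stable_local_imp_valuation:
  assumes stable: "stable_ring R"
    and m: "m \<in> R" "inverse m \<notin> R" "\<forall>x\<in>R. inverse x \<notin> R \<longrightarrow> x / m \<in> R"
    and qf: "quotient_field_is_univ R"
  shows "valuation_dom R"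
  unfolding valuation_dom_def
proof (intro allI impI)
  fix x :: 'a assume x0: "x \<noteq> 0"
  have m0: "m \<noteq> 0" using m(2) by auto
  show "x \<in> R \<or> inverse x \<in> R"
  proof (rule ccontr)
    assume "\<not> (x \<in> R \<or> inverse x \<in> R)"
    then have xR: "x \<notin> R" "inverse x \<notin> R" by auto
    define \<Sigma> where "\<Sigma> = {Q. divided_prime R Q \<and> (\<forall>v\<in>R. v * x \<in> R \<longrightarrow> v \<in> Q)}"
    \<comment> \<open>N = m R is the set of nonunits of R. It is the largest candidate and keeps
      \<open>\<Sigma>\<close> from being empty.\<close>
    define N where "N = {v \<in> R. v / m \<in> R}"
    have unitN: "inverse v \<in> R" if "v \<in> R" "v \<notin> N" for v
      using m(3) that by (auto simp: N_def)
    have "divided_prime R N"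
      unfolding divided_prime_def prime_ideal_def r_ideal_def
    proof (intro conjI ballI impI)
      show "submod R N"
        unfolding N_def by (rule submodI) (auto simp: add_divide_distrib add_mem mult_mem
            times_divide_eq_right[symmetric] simp del: times_divide_eq_right)
      show "N \<subseteq> R" by (auto simp: N_def)
      have "1 \<notin> N" using m(2) by (simp add: N_def inverse_eq_divide)
      then show "N \<noteq> R" using one_mem by blast
    next
      fix a b assume ab: "a \<in> R" "b \<in> R" "a * b \<in> N"
      show "a \<in> N \<or> b \<in> N"
      proof (rule ccontr)
        assume neg: "\<not> (a \<in> N \<or> b \<in> N)"
        then have "inverse a * inverse b * (a * b / m) \<in> R"
          using unitN ab by (intro mult_mem) (auto simp: N_def)
        moreover have "a \<noteq> 0" "b \<noteq> 0" using neg by (auto simp: N_def)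
        ultimately show False using m(2) by (simp add: field_simps)
      qed
    next
      fix a b assume "a \<in> R - N" "b \<in> R"
      then show "b / a \<in> R \<or> a / b \<in> R" using mult_mem[OF _ unitN] by (auto simp: divide_inverse)
    next
      fix a q assume "a \<in> R - N" "q \<in> N"
      then show "q / a \<in> R" using mult_mem[OF _ unitN] by (auto simp: divide_inverse N_def)
    qed
    moreover have "v \<in> N" if "v \<in> R" "v * x \<in> R" for v
    proof (rule ccontr)
      assume "v \<notin> N"
      then have "v \<noteq> 0" "inverse v * (v * x) \<in> R"
        using that unitN mult_mem by (auto simp: N_def)
      then show False using xR by (simp add: mult.assoc[symmetric])
    qed
    ultimately have N: "N \<in> \<Sigma>" by (auto simp: \<Sigma>_def)
    have prime: "prime_ideal R Q" if "Q \<in> \<Sigma>" for Q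
      using that by (simp add: \<Sigma>_def divided_prime_def)
    \<comment> \<open>An element of Q' outside Q divides all of Q in R, so Q is contained in
      Q'.\<close>
    have chain: "Q \<subseteq> Q' \<or> Q' \<subseteq> Q" if Q: "Q \<in> \<Sigma>" "Q' \<in> \<Sigma>" for Q Q'
    proof (cases "Q' \<subseteq> Q")
      case False
      then obtain a where a: "a \<in> Q'" "a \<notin> Q" by blast
      then have a': "a \<in> R - Q" using prime_subset[OF prime[OF Q(2)]] by blast
      have "q \<in> Q'" if "q \<in> Q" for q
      proof -
        have "q / a \<in> R" using Q(1) a' that by (simp add: \<Sigma>_def divided_prime_def)
        from submod_smult[OF prime_submod[OF prime[OF Q(2)]] this a(1)]
        show ?thesis using prime_complement(3)[OF prime[OF Q(1)] a'] by simp
      qed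
      then show ?thesis by blast
    qed simp
    define Q where "Q = \<Inter>\<Sigma>"
    have QN: "Q \<subseteq> N" using N by (auto simp: Q_def)
    have dQ: "divided_prime R Q"
      unfolding divided_prime_def prime_ideal_def r_ideal_def
    proof (intro conjI ballI impI)
      show "submod R Q"
        unfolding Q_def using prime_submod[OF prime]
        by (intro submodI) (auto intro: submod_zero submod_add submod_smult)
      show "Q \<subseteq> R" using QN by (auto simp: N_def)
      show "Q \<noteq> R" using QN prime_complement(1)[OF prime[OF N]] by blast
    next
      fix a b assume ab: "a \<in> R" "b \<in> R" "a * b \<in> Q"
      show "a \<in> Q \<or> b \<in> Q"
      proof (rule ccontr)
        assume "\<not> (a \<in> Q \<or> b \<in> Q)"
        then obtain Q1 Q2 where "Q1 \<in> \<Sigma>" "Q2 \<in> \<Sigma>" "a \<notin> Q1" "b \<notin> Q2" by (auto simp: Q_def)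
        then obtain Q3 where Q3: "Q3 \<in> \<Sigma>" "a \<notin> Q3" "b \<notin> Q3" using chain[of Q1 Q2] by blast
        then have "a * b \<in> R - Q3" using prime_complement(2)[OF prime[OF Q3(1)]] ab by blast
        then show False using ab(3) Q3(1) by (auto simp: Q_def)
      qed
    next
      fix a b assume "a \<in> R - Q" "b \<in> R"
      then show "b / a \<in> R \<or> a / b \<in> R"
        unfolding Q_def \<Sigma>_def divided_prime_def by blast
    next
      fix a q assume "a \<in> R - Q" "q \<in> Q"
      then show "q / a \<in> R"
        unfolding Q_def \<Sigma>_def divided_prime_def by blast
    qed
    have cond: "v \<in> Q" if "v \<in> R" "v * x \<in> R" for v
      using that by (auto simp: Q_def \<Sigma>_def)
    \<comment> \<open>A denominator d of x belongs to the conductor, hence to Q, so Q is nonzero as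
      the previous lemmas require.\<close>
    obtain a d where "a \<in> R" "d \<in> R" "d \<noteq> 0" "x = a / d"
      using qf unfolding quotient_field_is_univ_def by metis
    then have d: "d \<in> Q" "d \<noteq> 0" using cond[of d] by auto
    obtain p where p: "p \<in> Q" "p \<noteq> 0" "\<And>q. q \<in> Q \<Longrightarrow> q / p \<in> localize R Q R"
      using stable_divided_prime_principal[OF stable m dQ d] by blast
    define Q' where "Q' = {q. \<forall>n. q / p ^ n \<in> localize R Q R}"
    note nxt = divided_prime_principal_next[OF dQ p, folded Q'_def]
    have Qp: "prime_ideal R Q" using dQ by (simp add: divided_prime_def)
    note RW = localize_superset[OF Qp, of R]
    have xW: "x \<notin> localize R Q R"
      using cond mem_localize[OF Qp] by blast
    \<comment> \<open>Let v = \<open>p ^ k\<close> u be in the conductor but outside Q'. Then c =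
      \<open>p ^ k\<close> x is in W but not in \<open>p ^ k\<close> W, because x is not in W. So c
      = \<open>p ^ l\<close> t with l < k and t a unit of W, which makes the inverse of x a multiple
      of p in W, hence an element of Q and of R.\<close>
    have "v \<in> Q'" if v: "v \<in> R" "v * x \<in> R" for v
    proof (rule ccontr)
      assume "v \<notin> Q'"
      then obtain k u where u: "v = p ^ k * u" "u \<in> localize R Q R - Q" using nxt(3) v RW by blast
      have u0: "u \<noteq> 0" using u submod_zero[OF prime_submod[OF Qp]] by auto
      have iu: "inverse u \<in> localize R Q R" using divided_prime_localize_unit[OF dQ] u by blast
      define c where "c = p ^ k * x"
      have "inverse u * (v * x) \<in> localize R Q R"
        using localize_smult[OF Qp submod_self iu] v RW by blast
      then have c: "c \<in> localize R Q R" using u0 by (simp add: c_def u(1) field_simps)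
      have "c / p ^ k \<notin> localize R Q R" using xW p(2) by (simp add: c_def)
      then have "c \<notin> Q'" by (auto simp: Q'_def)
      then obtain l t where t: "c = p ^ l * t" "t \<in> localize R Q R - Q" using nxt(3) c by blast
      have "l < k"
      proof (rule ccontr)
        assume "\<not> l < k"
        then have "c / p ^ k = p ^ (l - k) * t"
          using t(1) p(2) by (simp add: power_diff)
        moreover interpret W: field_subring "localize R Q R"
          by unfold_locales (rule is_subring_localize[OF Qp])
        have "p ^ (l - k) * t \<in> localize R Q R"
          using t p(1) RW prime_subset[OF Qp] by (intro W.mult_mem W.power_mem) auto
        ultimately show False using \<open>c / p ^ k \<notin> _\<close> by simp
      qed
      then obtain j where j: "k = l + Suc j" using less_imp_Suc_add by auto
      have "t \<noteq> 0" using t submod_zero[OF prime_submod[OF Qp]] by auto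
      moreover have "p ^ l * (p ^ Suc j * x) = p ^ l * t" using t(1) by (simp add: c_def j power_add mult.assoc)
      ultimately have "inverse x = p ^ Suc j * inverse t" using p(2) x0 by (simp add: field_simps)
      also have "\<dots> = p ^ j * (inverse t * p)" by simp
      also have "\<dots> \<in> Q"
        using submod_smult[OF prime_submod[OF Qp] power_mem
            divided_prime_localize_mult[OF dQ divided_prime_localize_unit[OF dQ] p(1)]] t(2) p(1)
          prime_subset[OF Qp] by blast
      finally show False using xR(2) prime_subset[OF Qp] by blast
    qed
    then have "Q' \<in> \<Sigma>" using nxt(1) by (simp add: \<Sigma>_def)
    then show False using p(1) nxt(2) by (auto simp: Q_def)
  qed
qed

end

section \<open>Domains different from their quotient field\<close>

locale nonfield_domain = field_subring R for R :: "'a::field set" +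
  assumes quotient_field: "quotient_field_is_univ R" and nonfield: "R \<noteq> UNIV"
begin

text \<open>As R is not all of K, some nonzero b is a nonunit. The t-closure of b R misses 1,
  because 1 / b multiplies b R into R without being in R.\<close>

lemma ex_t_max: "\<exists>M. t_max R M"
proof -
  obtain x where "x \<notin> R" using nonfield by blast
  moreover obtain a b where "a \<in> R" "b \<in> R" "b \<noteq> 0" "x = a / b"
    using quotient_field unfolding quotient_field_is_univ_def by metis
  ultimately have b: "b \<in> R" "b \<noteq> 0" "inverse b \<notin> R"
    using mult_mem[of a "inverse b"] by (auto simp: divide_inverse)
  define I where "I = {x \<in> R. x / b \<in> R}"
  have sub: "submod R I"
    unfolding I_def by (rule submodI) (auto simp: add_divide_distrib add_mem mult_mem
        times_divide_eq_right[symmetric] simp del: times_divide_eq_right)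
  have nz: "nz_submod R I"
    using b by (intro nz_submodI[OF sub, of b]) (auto simp: I_def)
  have "1 \<notin> t_op R I"
  proof
    assume "1 \<in> t_op R I"
    then obtain S where S: "S \<subseteq> I" "\<And>y. \<forall>s\<in>S. y * s \<in> R \<Longrightarrow> 1 * y \<in> R"
      unfolding t_op_iff[OF sub] by blast
    from S(1) have "\<forall>s\<in>S. inverse b * s \<in> R"
      by (auto simp: I_def divide_inverse mult.commute)
    from S(2)[OF this] b show False by simp
  qed
  then show ?thesis using ex_t_max_superset[OF nz] by (auto simp: I_def)
qed

text \<open>The elements of R carrying x into E form an ideal D that no t-maximal ideal contains. D
  is nonzero since t-maximal ideals exist and contain 0. A finite subset of D with trivial inverse
  replaces the infinitely many local denominators of x.\<close>

lemma w_op_t_unit: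
  assumes "submod R E" "x \<in> w_op R E"
  obtains S where "finite S" "S \<subseteq> R" "\<exists>s\<in>S. s \<noteq> 0" "\<And>y. \<forall>s\<in>S. y * s \<in> R \<Longrightarrow> y \<in> R"
    "\<And>s. s \<in> S \<Longrightarrow> s * x \<in> E"
proof (cases "x = 0")
  case True
  then show ?thesis using that[of "{1}"] submod_zero[OF assms(1)] by auto
next
  case False
  define D where "D = {r \<in> R. r * x \<in> E}"
  have sm: "submod R D"
    unfolding D_def using submod_zero[OF assms(1)] submod_add[OF assms(1)] submod_smult[OF assms(1)]
    by (intro submodI) (auto simp: distrib_right mult.assoc intro: add_mem mult_mem)
  have D: "\<exists>s\<in>D. s \<notin> M" if "t_max R M" for M
    using assms(2) that by (auto simp: D_def mem_w_op mem_localize_t_max)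
  show ?thesis
  proof (cases "D = {0}")
    case True
    then have "\<not> t_max R M" for M
      using D[of M] submod_zero[OF t_max_submod] by blast
    then show ?thesis using ex_t_max by blast
  next
    case False
    then have "nz_submod R D" using sm by (simp add: nz_submod_def)
    then obtain S where "finite S" "S \<subseteq> D" "\<exists>s\<in>S. s \<noteq> 0" "\<And>y. \<forall>s\<in>S. y * s \<in> R \<Longrightarrow> y \<in> R"
      using t_unit_finite[of D] D by (auto simp: D_def)
    then show ?thesis using that[of S] by (auto simp: D_def)
  qed
qed

lemma w_op_ring: "w_op R R = R"
proof
  show "w_op R R \<subseteq> R"
  proof
    fix x assume "x \<in> w_op R R"
    then obtain S where S: "\<And>y. \<forall>s\<in>S. y * s \<in> R \<Longrightarrow> y \<in> R" "\<And>s. s \<in> S \<Longrightarrow> s * x \<in> R"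
      using w_op_t_unit[OF submod_self] by metis
    then show "x \<in> R" by (simp add: mult.commute)
  qed
qed (rule w_op_extensive)

lemma mem_ring_locally: "(\<And>M. t_max R M \<Longrightarrow> x \<in> localize R M R) \<Longrightarrow> x \<in> R"
  using w_op_ring by (auto simp: mem_w_op)

text \<open>If S x lies in I and (R : S) = R, then whatever multiplies S x into R multiplies x into
  R; so S x is a finite witness for x.\<close>

lemma w_op_subset_t_op:
  assumes "nz_submod R I" shows "w_op R I \<subseteq> t_op R I"
proof
  note sI = nz_submod_submod[OF assms]
  fix x assume x: "x \<in> w_op R I"
  show "x \<in> t_op R I"
  proof (cases "x = 0")
    case True
    then show ?thesis using submod_zero[OF submod_t_op[OF assms]] by simp
  next
    case False
    obtain S where S: "finite S" "\<exists>s\<in>S. s \<noteq> 0" "\<And>y. \<forall>s\<in>S. y * s \<in> R \<Longrightarrow> y \<in> R"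
        "\<And>s. s \<in> S \<Longrightarrow> s * x \<in> I"
      using w_op_t_unit[OF sI x] by metis
    show ?thesis
      unfolding t_op_iff[OF sI]
    proof (intro exI[of _ "(\<lambda>s. s * x) ` S"] conjI allI impI)
      fix y assume "\<forall>s\<in>(\<lambda>s. s * x) ` S. y * s \<in> R"
      then show "x * y \<in> R" by (intro S(3)) (auto simp: ac_simps)
    qed (use S False in auto)
  qed
qed

lemma t_ideal_w_ideal: "t_ideal R I \<Longrightarrow> w_ideal R I"
  using w_op_subset_t_op[OF t_ideal_nz] w_op_extensive t_ideal_nz
  unfolding w_ideal_def t_ideal_def by blast

section \<open>Stability as a local condition\<close>

lemma w_stable_idealD:
  assumes "w_stable_ideal R I" "t_max R M"
  shows "\<exists>s\<in>R - M. s \<in> smod_prod I (colon (Eend I) I)"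
proof -
  have "1 \<in> w_op R (smod_prod I (colon (Eend I) I))"
    using assms(1) one_Eend by (simp add: w_stable_ideal_def)
  then show ?thesis using assms(2) by (auto simp: mem_w_op mem_localize_t_max)
qed

lemma Eend_w_idealI:
  assumes "w_ideal R I" "\<And>M b. t_max R M \<Longrightarrow> b \<in> I \<Longrightarrow> y * b \<in> localize R M I"
  shows "y \<in> Eend I"
proof (rule EendI)
  fix b assume "b \<in> I"
  then have "y * b \<in> w_op R I" using assms(2) by (simp add: mem_w_op)
  then show "y * b \<in> I" using assms(1) by (simp add: w_ideal_def)
qed

text \<open>E(I) is w-closed because I is, which bounds the w-closure of the product. For the
  converse inclusion, the product is an E(I)-module, so y in E(I) gets the local denominator s from
  y s in the product.\<close>

lemma w_stable_idealI:
  assumes I: "w_ideal R I" and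
    st: "\<And>M. t_max R M \<Longrightarrow> \<exists>s\<in>R - M. s \<in> smod_prod I (colon (Eend I) I)"
  shows "w_stable_ideal R I"
  unfolding w_stable_ideal_def
proof
  have sI: "submod R I" using I by (simp add: w_ideal_def nz_submod_submod)
  have sub: "smod_prod I (colon (Eend I) I) \<subseteq> Eend I"
    using submod_Eend[OF sI] by (rule smod_prod_subset) (metis colonD mult.commute)
  show "w_op R (smod_prod I (colon (Eend I) I)) \<subseteq> Eend I"
  proof
    fix y assume y: "y \<in> w_op R (smod_prod I (colon (Eend I) I))"
    show "y \<in> Eend I"
    proof (rule Eend_w_idealI[OF I])
      fix M b assume M: "t_max R M" and b: "b \<in> I"
      then obtain s where s: "s \<in> R - M" "s * y \<in> Eend I"
        using y sub by (auto simp: mem_w_op mem_localize_t_max)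
      then have "s * (y * b) \<in> I" using EendD[OF s(2) b] by (simp add: mult.assoc)
      then show "y * b \<in> localize R M I" using M s(1) by (auto intro: localizeI)
    qed
  qed
  show "Eend I \<subseteq> w_op R (smod_prod I (colon (Eend I) I))"
  proof
    fix y assume y: "y \<in> Eend I"
    have "submod (Eend I) I" using sI by (auto simp: submod_def intro: EendD)
    then have "submod (Eend I) (smod_prod I (colon (Eend I) I))"
      by (rule submod_smod_prod)
    note smult = submod_smult[OF this y]
    show "y \<in> w_op R (smod_prod I (colon (Eend I) I))"
      unfolding mem_w_op
    proof (intro allI impI)
      fix M assume M: "t_max R M"
      then obtain s where "s \<in> R - M" "s \<in> smod_prod I (colon (Eend I) I)" using st by blast
      with smult[of s] show "y \<in> localize R M (smod_prod I (colon (Eend I) I))"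
        by (intro localizeI[OF M, of s]) (auto simp: mult.commute)
    qed
  qed
qed

text \<open>\<open>w_stable_domain\<close> tests integral ideals only. The multiple d I is integral
  and again a w-ideal, and its stability is scaled back to I.\<close>

lemma w_stable_domainD:
  assumes "w_stable_domain R" and I: "w_ideal R I" and d: "d \<noteq> 0" "\<And>x. x \<in> I \<Longrightarrow> d * x \<in> R"
    and M: "t_max R M"
  shows "\<exists>s\<in>R - M. s \<in> smod_prod I (colon (Eend I) I)"
proof -
  have nzI: "nz_submod R I" and wI: "w_op R I = I" using I by (auto simp: w_ideal_def)
  note sI = nz_submod_submod[OF nzI]
  let ?J = "(*) d ` I"
  have J: "x \<in> ?J \<longleftrightarrow> x / d \<in> I" for x
    using d(1) by (auto intro: image_eqI[of _ _ "x / d"])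
  have sJ: "submod R ?J"
    using submod_zero[OF sI] submod_add[OF sI] submod_smult[OF sI]
    by (intro submodI) (auto simp: J add_divide_distrib times_divide_eq_right[symmetric]
        simp del: times_divide_eq_right)
  obtain z where "z \<in> I" "z \<noteq> 0" using nzI by (rule nz_submodE)
  then have nzJ: "nz_submod R ?J" using d(1) by (intro nz_submodI[OF sJ, of "d * z"]) auto
  have "w_op R ?J \<subseteq> ?J"
  proof
    fix x assume "x \<in> w_op R ?J"
    then have "x / d \<in> w_op R I"
      by (simp add: mem_w_op mem_localize_t_max J)
    then show "x \<in> ?J" using wI J by simp
  qed
  then have "w_ideal R ?J" using nzJ w_op_extensive[of ?J] by (auto simp: w_ideal_def)
  moreover have "?J \<subseteq> R" using d by auto
  ultimately have "w_stable_ideal R ?J"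
    using assms(1) unfolding w_stable_domain_def by blast
  from w_stable_idealD[OF this M] show ?thesis using smod_prod_scale[OF d(1), of I] by blast
qed

section \<open>Localizations that are valuation domains\<close>

lemma valuation_domD:
  assumes "valuation_dom V" "is_subring V" shows "x / y \<in> V \<or> y / x \<in> V"
proof (cases "x = 0 \<or> y = 0")
  case True
  then show ?thesis using assms(2) by (auto simp: is_subring_def)
next
  case False
  then show ?thesis using assms(1)[unfolded valuation_dom_def, rule_format, of "x / y"] by simp
qed

lemma common_denominator:
  assumes "prime_ideal R P" "finite S" "S \<subseteq> localize R P R"
  shows "\<exists>s\<in>R - P. \<forall>b\<in>S. s * b \<in> R"
  using assms(2,3)
proof (induction S)
  case empty
  then show ?case using prime_complement(1)[OF assms(1)] by blast
next
  case (insert x S)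
  then obtain s t where s: "s \<in> R - P" "\<forall>b\<in>S. s * b \<in> R" and t: "t \<in> R - P" "t * x \<in> R"
    by (auto simp: mem_localize[OF assms(1)])
  have "s * t * b \<in> R" if "b \<in> insert x S" for b
    using that s t mult_mem[of t "s * b"] mult_mem[of s "t * x"] by (auto simp: ac_simps)
  then show ?case using prime_complement(2)[OF assms(1) s(1) t(1)] by blast
qed

lemma valuation_finite_principal:
  assumes V: "valuation_dom V" "is_subring V" and "finite S" "\<exists>s\<in>S. s \<noteq> 0"
  shows "\<exists>a\<in>S. a \<noteq> 0 \<and> (\<forall>b\<in>S. b / a \<in> V)"
  using assms(3,4)
proof (induction S)
  case (insert x S)
  have V01: "0 \<in> V" "1 \<in> V" and Vm: "\<And>x y. x \<in> V \<Longrightarrow> y \<in> V \<Longrightarrow> x * y \<in> V"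
    using V(2) by (auto simp: is_subring_def)
  show ?case
  proof (cases "\<exists>s\<in>S. s \<noteq> 0")
    case False
    then show ?thesis using insert.prems V01 by (intro bexI[of _ x]) auto
  next
    case True
    then obtain a where a: "a \<in> S" "a \<noteq> 0" "\<forall>b\<in>S. b / a \<in> V" using insert.IH by blast
    consider "x / a \<in> V" | "x \<noteq> 0" "a / x \<in> V"
      using valuation_domD[OF V, of x a] V01 by fastforce
    then show ?thesis
    proof cases
      case 1
      then show ?thesis using a by blast
    next
      case 2
      have "b / x \<in> V" if "b \<in> S" for b
        using Vm[of "b / a" "a / x"] a that 2 by simp
      then show ?thesis using 2 V01 by (intro bexI[of _ x]) auto
    qed
  qed
qed auto

lemma PvMD_valuation:
  assumes "PvMD R" "t_max R M"
  shows "valuation_dom (localize R M R)" "is_subring (localize R M R)"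
  using assms is_subring_localize[OF t_max_prime] by (auto simp: PvMD_def)

text \<open>Some a in S generates S over the valuation ring R_M. A common denominator s of the
  quotients b / a gives y = s / a in (R : S), with a y = s outside M.\<close>

lemma PvMD_finite_invertible:
  assumes "PvMD R" "t_max R M" "finite S" "\<exists>s\<in>S. s \<noteq> 0"
  shows "\<exists>a\<in>S. \<exists>y\<in>colon R S. a * y \<in> R - M"
proof -
  obtain a where a: "a \<in> S" "a \<noteq> 0" "\<forall>b\<in>S. b / a \<in> localize R M R"
    using valuation_finite_principal[OF PvMD_valuation[OF assms(1,2)] assms(3,4)] by blast
  then obtain s where s: "s \<in> R - M" "\<forall>b\<in>(\<lambda>b. b / a) ` S. s * b \<in> R"
    using common_denominator[OF t_max_prime[OF assms(2)], of "(\<lambda>b. b / a) ` S"] assms(3) by auto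
  then have "s / a \<in> colon R S" by (auto intro!: colonI)
  then show ?thesis using a s by (intro bexI[of _ a] bexI[of _ "s / a"]) auto
qed

text \<open>For x in the t-closure with finite witness S, choose a in S and y in (R : S) with a y
  outside M. Then x y is in R, so (a y) x = (x y) a is in I and a y is a denominator for x at
  M.\<close>

lemma PvMD_t_op_eq_w_op:
  assumes "PvMD R" "nz_submod R I" shows "t_op R I = w_op R I"
proof
  note sI = nz_submod_submod[OF assms(2)]
  show "t_op R I \<subseteq> w_op R I"
  proof
    fix x assume "x \<in> t_op R I"
    then obtain S where S: "finite S" "S \<subseteq> I" "\<exists>s\<in>S. s \<noteq> 0"
        "\<And>y. \<forall>s\<in>S. y * s \<in> R \<Longrightarrow> x * y \<in> R"
      unfolding t_op_iff[OF sI] by blast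
    show "x \<in> w_op R I"
      unfolding mem_w_op
    proof (intro allI impI)
      fix M assume M: "t_max R M"
      obtain a y where a: "a \<in> S" "y \<in> colon R S" "a * y \<in> R - M"
        using PvMD_finite_invertible[OF assms(1) M S(1,3)] by blast
      then have "x * y \<in> R" using S(4) by (auto simp: colon_def)
      then have "(x * y) * a \<in> I" using a S(2) submod_smult[OF sI] by blast
      then show "x \<in> localize R M I"
        using a by (intro localizeI[OF M, of "a * y"]) (auto simp: ac_simps)
    qed
  qed
  show "w_op R I \<subseteq> t_op R I" by (rule w_op_subset_t_op[OF assms(2)])
qed

lemma PvMD_integrally_closed:
  assumes "PvMD R" shows "integrally_closed R"
  unfolding integrally_closed_def
proof (intro allI impI)
  fix x :: 'a
  assume "\<exists>n>0. \<exists>c. (\<forall>i<n. c i \<in> R) \<and> x ^ n + (\<Sum>i<n. c i * x ^ i) = 0"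
  then obtain n c where n: "n > 0" and c: "\<And>i. i < n \<Longrightarrow> c i \<in> R"
    and eq: "x ^ n + (\<Sum>i<n. c i * x ^ i) = 0" by blast
  show "x \<in> R"
  proof (rule mem_ring_locally)
    fix M assume M: "t_max R M"
    interpret V: field_subring "localize R M R"
      by unfold_locales (rule PvMD_valuation(2)[OF assms M])
    show "x \<in> localize R M R"
    proof (cases "x = 0 \<or> x \<in> localize R M R")
      case False
      then have x0: "x \<noteq> 0" and inv: "inverse x \<in> localize R M R"
        using PvMD_valuation(1)[OF assms M] by (auto simp: valuation_dom_def)
      have "(\<Sum>i<n. c i * inverse x ^ (n - 1 - i)) \<in> localize R M R"
        using c localize_superset[OF t_max_prime[OF M], of R]
        by (intro submod_sum[OF V.submod_self] V.mult_mem V.power_mem inv) auto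
      \<comment> \<open>The integral equation divided by \<open>x ^ (n - 1)\<close> expresses x
        through powers of its inverse, which lies in the valuation ring.\<close>
      moreover have "x = - (\<Sum>i<n. c i * inverse x ^ (n - 1 - i))"
      proof -
        have "x ^ (n - 1) * (\<Sum>i<n. c i * inverse x ^ (n - 1 - i)) = (\<Sum>i<n. c i * x ^ i)"
          unfolding sum_distrib_left
        proof (rule sum.cong)
          fix i assume "i \<in> {..<n}"
          then have "x ^ (n - 1) = x ^ i * x ^ (n - 1 - i)"
            by (simp add: power_add[symmetric])
          then show "x ^ (n - 1) * (c i * inverse x ^ (n - 1 - i)) = c i * x ^ i"
            using x0 by (simp add: power_inverse)
        qed simp
        also have "\<dots> = - (x ^ n)" using eq by (simp add: eq_neg_iff_add_eq_0 add.commute)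
        also have "x ^ n = x ^ (n - 1) * x" using n by (simp add: power_eq_if mult.commute)
        finally have "x ^ (n - 1) * (\<Sum>i<n. c i * inverse x ^ (n - 1 - i)) = x ^ (n - 1) * (- x)"
          by simp
        then have "(\<Sum>i<n. c i * inverse x ^ (n - 1 - i)) = - x"
          using x0 by (simp only: mult_cancel_left) simp
        then show ?thesis by simp
      qed
      ultimately show ?thesis using V.neg_mem by metis
    qed auto
  qed
qed

lemma integrally_closed_quadratic:
  assumes "integrally_closed R" "p \<in> R" "q \<in> R" "x\<^sup>2 + p * x + q = 0" shows "x \<in> R"
proof -
  have "\<exists>n>0. \<exists>c. (\<forall>i<n. c i \<in> R) \<and> x ^ n + (\<Sum>i<n. c i * x ^ i) = 0"
    using assms(2-)
    by (intro exI[of _ "2::nat"] conjI exI[of _ "\<lambda>i::nat. if i = 0 then q else p"])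
      (auto simp: numeral_2_eq_2 algebra_simps)
  then show ?thesis using assms(1) unfolding integrally_closed_def by blast
qed

text \<open>For x = a / b, let I be the w-closure of the ideal generated by a and b. A determinant
  argument shows E(I) = R, so stability makes I invertible at M, and this makes a and b comparable
  in R_M.\<close>

lemma integrally_closed_w_stable_imp_PvMD:
  assumes ic: "integrally_closed R" and st: "w_stable_domain R"
  shows "PvMD R"
  unfolding PvMD_def valuation_dom_def
proof (intro allI impI)
  fix M and x :: 'a assume M: "t_max R M" and "x \<noteq> 0"
  moreover obtain a b where "a \<in> R" "b \<in> R" "b \<noteq> 0" "x = a / b"
    using quotient_field unfolding quotient_field_is_univ_def by metis
  ultimately have ab: "a \<in> R" "b \<in> R" "a \<noteq> 0" "b \<noteq> 0" and x: "x = a / b" by auto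
  define J where "J = {r * a + s * b |r s. r \<in> R \<and> s \<in> R}"
  have J: "r * a + s * b \<in> J" if "r \<in> R" "s \<in> R" for r s
    using that by (auto simp: J_def)
  have sJ: "submod R J"
  proof (rule submodI)
    show "0 \<in> J" using J[of 0 0] by simp
    fix u v assume "u \<in> J" "v \<in> J"
    then obtain r s r' s' where "u = r * a + s * b" "v = r' * a + s' * b"
        "r \<in> R" "s \<in> R" "r' \<in> R" "s' \<in> R" by (auto simp: J_def)
    then show "u + v \<in> J" using J[of "r + r'" "s + s'"] by (simp add: algebra_simps add_mem)
  next
    fix t u assume "t \<in> R" "u \<in> J"
    moreover then obtain r s where "u = r * a + s * b" "r \<in> R" "s \<in> R" by (auto simp: J_def)
    ultimately show "t * u \<in> J" using J[of "t * r" "t * s"] by (simp add: algebra_simps mult_mem)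
  qed
  have aJ: "a \<in> J" and bJ: "b \<in> J" using J[of 1 0] J[of 0 1] by auto
  have JR: "J \<subseteq> R" using ab by (auto simp: J_def intro: add_mem mult_mem)
  define I where "I = w_op R J"
  have aI: "a \<in> I" and bI: "b \<in> I" using aJ bJ w_op_extensive[of J] by (auto simp: I_def)
  have IR: "I \<subseteq> R" using w_op_mono[OF JR] by (simp add: I_def w_op_ring)
  have "nz_submod R I" using submod_w_op[OF sJ] aI ab by (intro nz_submodI) (auto simp: I_def)
  then have "w_ideal R I" by (simp add: w_ideal_def I_def w_op_idem[OF sJ])
  then have "w_stable_ideal R I" using st IR by (simp add: w_stable_domain_def)
  then obtain s where s: "s \<in> R - M" "s \<in> smod_prod I (colon (Eend I) I)"
    using w_stable_idealD[OF _ M] by blast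
  have EI: "Eend I \<subseteq> R"
  proof
    fix y assume y: "y \<in> Eend I"
    show "y \<in> R"
    proof (rule mem_ring_locally)
      fix M assume M: "t_max R M"
      have "y * a \<in> localize R M J" "y * b \<in> localize R M J"
        using EendD[OF y aI] EendD[OF y bI] M by (auto simp: I_def mem_w_op)
      then obtain t u where t: "t \<in> R - M" "t * (y * a) \<in> J" and u: "u \<in> R - M" "u * (y * b) \<in> J"
        by (auto simp: mem_localize_t_max[OF M])
      \<comment> \<open>Multiplying y by both local denominators gives a z that maps the
        two-generated ideal J into itself. The characteristic polynomial of its 2 by 2 matrix is the
        monic quadratic equation for z over R.\<close>
      define z where "z = t * u * y"
      have "u * (t * (y * a)) \<in> J" "t * (u * (y * b)) \<in> J"
        using submod_smult[OF sJ] t u by auto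
      then have "z * a \<in> J" "z * b \<in> J" by (simp_all add: z_def ac_simps)
      then obtain p q p' q' where c: "p \<in> R" "q \<in> R" "p' \<in> R" "q' \<in> R"
        and eq: "z * a = p * a + q * b" "z * b = p' * a + q' * b" by (auto simp: J_def)
      have "(z - p) * a = q * b" "(z - q') * b = p' * a" using eq by (auto simp: algebra_simps)
      then have "((z - p) * a) * ((z - q') * b) = (q * b) * (p' * a)" by simp
      then have "((z - p) * (z - q')) * (a * b) = (q * p') * (a * b)" by (simp only: ac_simps)
      then have "(z - p) * (z - q') = q * p'" using ab by simp
      then have "z\<^sup>2 + (- (p + q')) * z + (p * q' - q * p') = 0"
        by (simp add: power2_eq_square algebra_simps)
      then have "z \<in> R"
        by (rule integrally_closed_quadratic[OF ic, rotated 2]) (auto intro: c neg_mem add_mem diff_mem mult_mem)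
      then show "y \<in> localize R M R"
        using t_max_complement(2)[OF M t(1) u(1)] by (auto intro: localizeI[OF M] simp: z_def)
    qed
  qed
  \<comment> \<open>Stability supplies j in I and y in (R : I) with j y outside M. A multiple t j is
    a combination of a and b, so a y or b y is outside M and serves as the denominator for b / a or
    a / b.\<close>
  obtain j y where j: "j \<in> I" "y \<in> colon (Eend I) I" "j * y \<notin> M"
    using s by (auto elim: smod_prod_notin[OF t_max_submod[OF M]])
  have yR: "i * y \<in> R" if "i \<in> I" for i
    using colonD[OF j(2) that] EI by (auto simp: mult.commute)
  obtain t where t: "t \<in> R - M" "t * j \<in> J"
    using j(1) M by (auto simp: I_def mem_w_op mem_localize_t_max)
  then obtain r s where rs: "r \<in> R" "s \<in> R" "t * j = r * a + s * b" by (auto simp: J_def)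
  have "t * (j * y) \<in> R - M" using t_max_complement(2)[OF M t(1)] yR j by blast
  moreover have "t * (j * y) = r * (a * y) + s * (b * y)"
    using rs(3) by (simp add: mult.assoc[symmetric] distrib_right)
  ultimately have "a * y \<notin> M \<or> b * y \<notin> M"
    using submod_add[OF t_max_submod[OF M]] submod_smult[OF t_max_submod[OF M]] rs by auto
  moreover have "y \<noteq> 0" using j(3) submod_zero[OF t_max_submod[OF M]] by auto
  moreover have "x = (a * y) / (b * y)" "inverse x = (b * y) / (a * y)" using x \<open>y \<noteq> 0\<close> by auto
  ultimately show "x \<in> localize R M R \<or> inverse x \<in> localize R M R"
    using yR[OF aI] yR[OF bI] unfolding localize_def by auto
qed

text \<open>Scale the fractional ideal into R_M and contract it to J in R. Contractions from R_M are
  w-ideals, so J is w-stable. J generates the scaled ideal over R_M, hence its colon embeds in that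
  of the scaled ideal, and the element s outside M becomes a unit.\<close>

lemma w_stable_imp_stable_localize:
  assumes st: "w_stable_domain R" and M: "t_max R M"
  shows "stable_ring (localize R M R)"
  unfolding stable_ring_def
proof (intro allI impI, elim conjE)
  let ?V = "localize R M R"
  fix I' :: "'a set" and d
  assume nzI': "nz_submod ?V I'" and d: "d \<noteq> 0" "\<forall>x\<in>I'. d * x \<in> ?V"
  note sI' = nz_submod_submod[OF nzI']
  note RV = localize_superset[OF t_max_prime[OF M], of R]
  define I where "I = (*) d ` I'"
  have I: "x \<in> I \<longleftrightarrow> x / d \<in> I'" for x
    using d(1) by (auto simp: I_def intro: image_eqI[of _ _ "x / d"])
  have sI: "submod ?V I"
    using submod_zero[OF sI'] submod_add[OF sI'] submod_smult[OF sI']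
    by (intro submodI) (auto simp: I add_divide_distrib times_divide_eq_right[symmetric]
        simp del: times_divide_eq_right)
  have IV: "I \<subseteq> ?V" using d by (auto simp: I_def)
  have divI: "x \<in> I" if "s \<in> R - M" "s * x \<in> I" for s x
    using submod_smult[OF sI inverse_mem_localize[OF t_max_prime[OF M] that(1)] that(2)]
      t_max_complement(3)[OF M that(1)] by (simp add: mult.assoc[symmetric])
  define J where "J = I \<inter> R"
  have sJ: "submod R J"
    unfolding J_def using submod_zero[OF sI] submod_add[OF sI] submod_smult[OF sI] RV
    by (intro submodI) (auto intro: add_mem mult_mem)
  have denom: "\<exists>s\<in>R - M. s * x \<in> J" if "x \<in> I" for x
  proof -
    obtain s where s: "s \<in> R - M" "s * x \<in> R" using IV \<open>x \<in> I\<close> mem_localize_t_max[OF M] by blast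
    moreover have "s * x \<in> I" using submod_smult[OF sI] s RV \<open>x \<in> I\<close> by blast
    ultimately show ?thesis by (auto simp: J_def)
  qed
  obtain z where "z \<in> I'" "z \<noteq> 0" using nzI' by (rule nz_submodE)
  then have "d * z \<in> I" "d * z \<noteq> 0" using d(1) by (auto simp: I_def)
  then obtain s where "s \<in> R - M" "s * (d * z) \<in> J" "d * z \<noteq> 0" using denom by blast
  then have nzJ: "nz_submod R J" using t_max_complement(3)[OF M] by (intro nz_submodI[OF sJ]) auto
  have "w_op R J \<subseteq> J"
  proof
    fix x assume x: "x \<in> w_op R J"
    then have "x \<in> R" using w_op_mono[of J R] w_op_ring by (auto simp: J_def)
    moreover obtain s where "s \<in> R - M" "s * x \<in> J" using x M by (auto simp: mem_w_op mem_localize_t_max)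
    ultimately show "x \<in> J" using divI by (auto simp: J_def)
  qed
  then have "w_ideal R J" using nzJ w_op_extensive[of J] by (auto simp: w_ideal_def)
  then have "w_stable_ideal R J" using st by (auto simp: w_stable_domain_def J_def)
  then obtain s where s: "s \<in> R - M" "s \<in> smod_prod J (colon (Eend J) J)"
    using w_stable_idealD[OF _ M] by blast
  note sP = submod_smod_prod[OF sI, of "colon (Eend I) I"]
  have "y \<in> colon (Eend I) I" if y: "y \<in> colon (Eend J) J" for y
  proof (intro colonI EendI)
    fix i k assume ik: "i \<in> I" "k \<in> I"
    then obtain t u where t: "t \<in> R - M" "t * i \<in> J" and u: "u \<in> R - M" "u * k \<in> J"
      using denom by meson
    have "(y * (t * i)) * (u * k) \<in> J" by (rule EendD[OF colonD[OF y t(2)] u(2)])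
    then have "(t * u) * (y * i * k) \<in> I" by (simp add: J_def ac_simps)
    then show "y * i * k \<in> I" using divI t_max_complement(2)[OF M t(1) u(1)] by blast
  qed
  then have "smod_prod J (colon (Eend J) J) \<subseteq> smod_prod I (colon (Eend I) I)"
    by (intro smod_prod_subset[OF sP] smod_prod_mult) (auto simp: J_def)
  then have "inverse s * s \<in> smod_prod I (colon (Eend I) I)"
    using s submod_smult[OF sP inverse_mem_localize[OF t_max_prime[OF M] s(1)]] by blast
  then have "1 \<in> smod_prod I (colon (Eend I) I)"
    using t_max_complement(3)[OF M s(1)] by simp
  then show "1 \<in> smod_prod I' (colon (Eend I') I')"
    using smod_prod_scale[OF d(1), of I'] by (auto simp: I_def)
qed

text \<open>If M (R : M) were inside M, so would be its t-closure, which is R. The resulting m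
  generates M locally at M.\<close>

lemma t_invertible_t_max:
  assumes M: "t_max R M" and "t_invertible R M"
  shows "\<exists>m\<in>M. \<exists>y\<in>colon R M. m * y \<in> R - M"
proof -
  have "\<not> smod_prod M (colon R M) \<subseteq> M"
  proof
    assume "smod_prod M (colon R M) \<subseteq> M"
    from t_op_mono[OF this] have "R \<subseteq> M"
      using assms(2) t_max_ideal(1)[OF M] by (simp add: t_invertible_def t_ideal_def)
    then show False using one_notin_t_max[OF M] one_mem by blast
  qed
  then obtain m y where "m \<in> M" "y \<in> colon R M" "m * y \<notin> M"
    using smod_prod_notin[OF t_max_submod[OF M]] by (metis subsetI)
  then show ?thesis using colonD[of y R M m] by (auto simp: mult.commute)
qed

lemma w_stable_t_invertible_imp_PvMD:
  assumes st: "w_stable_domain R" and inv: "\<And>M. t_max R M \<Longrightarrow> t_invertible R M"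
  shows "PvMD R"
  unfolding PvMD_def
proof (intro allI impI)
  fix M assume M: "t_max R M"
  let ?V = "localize R M R"
  note RV = localize_superset[OF t_max_prime[OF M], of R]
  interpret V: field_subring ?V
    by unfold_locales (rule is_subring_localize[OF t_max_prime[OF M]])
  obtain m y where my: "m \<in> M" "y \<in> colon R M" "m * y \<in> R - M"
    using t_invertible_t_max[OF M inv[OF M]] by blast
  have 0: "m \<noteq> 0" "y \<noteq> 0" using t_max_complement(3)[OF M my(3)] by auto
  show "valuation_dom ?V"
  proof (rule V.stable_local_imp_valuation[of m])
    show "stable_ring ?V" by (rule w_stable_imp_stable_localize[OF st M])
    show "m \<in> ?V" using my(1) t_max_ideal(2)[OF M] RV by blast
    show "inverse m \<notin> ?V"
    proof
      assume "inverse m \<in> ?V"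
      then obtain s where s: "s \<in> R - M" "s * inverse m \<in> R" by (auto simp: mem_localize_t_max[OF M])
      have "s * inverse m * m \<in> M" by (rule submod_smult[OF t_max_submod[OF M] s(2) my(1)])
      then show False using s(1) 0 by (simp add: mult.assoc)
    qed
    show "\<forall>x\<in>?V. inverse x \<notin> ?V \<longrightarrow> x / m \<in> ?V"
    proof (intro ballI impI)
      fix x assume x: "x \<in> ?V" "inverse x \<notin> ?V"
      then have x0: "x \<noteq> 0" by auto
      obtain t where t: "t \<in> R - M" "t * x \<in> R" using x(1) by (auto simp: mem_localize_t_max[OF M])
      have "t * x \<in> M"
      proof (rule ccontr)
        assume "t * x \<notin> M"
        then have "inverse x \<in> ?V"
          using t x0 by (intro localizeI[OF M, of "t * x"]) (auto simp: mult.assoc)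
        then show False using x(2) by blast
      qed
      then have "y * (t * x) \<in> R" by (rule colonD[OF my(2)])
      \<comment> \<open>The factor t (m y) is outside M, so it is a denominator for x / m: every
        nonunit of R_M is a multiple of m.\<close>
      moreover have "y * (t * x) = (t * (m * y)) * (x / m)" using 0 by simp
      ultimately show "x / m \<in> ?V"
        using t_max_complement(2)[OF M t(1) my(3)] by (intro localizeI[OF M]) auto
    qed
    show "quotient_field_is_univ ?V"
      using quotient_field RV unfolding quotient_field_is_univ_def by blast
  qed
qed

section \<open>Finite t-character\<close>

text \<open>At M, an endomorphism y outside R_M has a nonunit inverse there, so some s / y with s
  outside M lies in M; applying y puts s into M. At another t-maximal M', an element of M outside M'
  is a denominator for y.\<close>

lemma Eend_t_max:
  assumes "PvMD R" and M: "t_max R M" shows "Eend M = R"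
proof
  show "Eend M \<subseteq> R"
  proof
    fix y assume y: "y \<in> Eend M"
    show "y \<in> R"
    proof (rule mem_ring_locally)
      fix M' assume M': "t_max R M'"
      show "y \<in> localize R M' R"
      proof (cases "M' = M")
        case True
        show ?thesis
        proof (rule ccontr)
          assume ny: "y \<notin> localize R M' R"
          then have y0: "y \<noteq> 0" using localize_superset[OF t_max_prime[OF M'], of R] zero_mem by blast
          then have "inverse y \<in> localize R M R"
            using PvMD_valuation(1)[OF assms] ny True by (auto simp: valuation_dom_def)
          then obtain s where s: "s \<in> R - M" "s * inverse y \<in> R"
            by (auto simp: mem_localize_t_max[OF M])
          have "s * inverse y \<in> M"
          proof (rule ccontr)
            assume "s * inverse y \<notin> M"
            then have "y \<in> localize R M R"
              using s y0 by (intro localizeI[OF M, of "s * inverse y"]) (auto simp: mult.assoc)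
            then show False using ny True by simp
          qed
          from EendD[OF y this] show False using s(1) y0 by (simp add: mult.left_commute)
        qed
      next
        case False
        then obtain r where r: "r \<in> M" "r \<notin> M'" using t_max_incomparable[OF M M'] by blast
        then have "y * r \<in> R" "r \<in> R" using EendD[OF y r(1)] t_max_ideal(2)[OF M] by auto
        then show ?thesis using r by (intro localizeI[OF M', of r]) (auto simp: mult.commute)
      qed
    qed
  qed
  show "R \<subseteq> Eend M" by (rule ring_subset_Eend[OF t_max_submod[OF M]])
qed

lemma w_stable_t_max_t_invertible:
  assumes "PvMD R" and M: "t_max R M" and st: "w_stable_ideal R M"
  shows "t_invertible R M"
  unfolding t_invertible_def
proof
  let ?X = "smod_prod M (colon R M)"
  note E = Eend_t_max[OF assms(1) M]
  obtain s where s: "s \<in> R - M" "s \<in> ?X" using w_stable_idealD[OF st M] by (auto simp: E)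
  have nz: "nz_submod R ?X"
    using submod_smod_prod[OF t_max_submod[OF M]] s t_max_complement(3)[OF M s(1)]
    by (blast intro: nz_submodI)
  have "?X \<subseteq> R" by (rule smod_prod_subset[OF submod_self]) (metis colonD mult.commute)
  then show "t_op R ?X \<subseteq> R" by (rule t_op_subset_ring[OF nz])
  have "w_op R ?X = R" using st by (simp add: w_stable_ideal_def E)
  then show "R \<subseteq> t_op R ?X" using w_op_subset_t_op[OF nz] by simp
qed

text \<open>The sum of the (R : M) over X is nonintegral at every M in X, while each of its elements
  is integral at all but finitely many t-maximal ideals. Stability produces finitely many elements
  which, at each t-maximal ideal, include a unit, and each of which multiplies the whole module into
  R_M for almost all M. An infinite X then contains some M where the module is integral.\<close>

lemma w_stable_t_invertible_imp_t_finite_char: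
  assumes st: "w_stable_domain R" and inv: "\<And>M. t_max R M \<Longrightarrow> t_invertible R M"
  shows "t_finite_char R"
  unfolding t_finite_char_def
proof (intro ballI impI, rule ccontr)
  fix x assume x: "x \<in> R" "x \<noteq> 0" and "infinite {M. t_max R M \<and> x \<in> M}"
  then obtain X where X: "X = {M. t_max R M \<and> x \<in> M}" and infX: "infinite X" by blast
  note loc = t_max_prime
  \<comment> \<open>(R : M) becomes trivial at every t-maximal M' other than M: an element of M
    outside M' clears denominators.\<close>
  have other: "y \<in> localize R M' R" if "t_max R M" "t_max R M'" "M \<noteq> M'" "y \<in> colon R M" for M M' y
  proof -
    obtain r where r: "r \<in> M" "r \<notin> M'"
      using t_max_incomparable[of M M'] \<open>M \<noteq> M'\<close> \<open>t_max R M\<close> \<open>t_max R M'\<close> by blast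
    then have "y * r \<in> R" "r \<in> R" using colonD[OF that(4) r(1)] t_max_ideal(2)[OF that(1)] by auto
    then show ?thesis using r by (intro localizeI[OF that(2), of r]) (auto simp: mult.commute)
  qed
  \<comment> \<open>\<open>smod_prod\<close> consists of finite sums, so this is the R-module sum of
    all (R : M) with M in X.\<close>
  define B where "B = smod_prod R (\<Union>M\<in>X. colon R M)"
  have sB: "submod R B" unfolding B_def by (rule submod_smod_prod[OF submod_self])
  have colB: "colon R M \<subseteq> B" if "M \<in> X" for M
    unfolding B_def using smod_prod_mult[OF one_mem, of _ "\<Union>M\<in>X. colon R M"] that by fastforce
  obtain M0 where M0: "M0 \<in> X" using infX by (metis finite.emptyI ex_in_conv)
  have "1 \<in> colon R M0" using M0 X t_max_ideal(2) by (auto simp: colon_def)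
  then have oneB: "1 \<in> B" using colB[OF M0] by blast
  have xB: "x * b \<in> R" if "b \<in> B" for b
    using that unfolding B_def
  proof (induction rule: smod_prod_induct)
    case (mult a b)
    then have "b * x \<in> R" using X by (auto intro: colonD)
    then have "a * (b * x) \<in> R" by (rule mult_mem[OF mult(1)])
    then show ?case by (simp add: ac_simps)
  qed (auto simp: distrib_left intro: add_mem)
  define I where "I = w_op R B"
  have BI: "B \<subseteq> I" unfolding I_def by (rule w_op_extensive)
  have sI: "submod R I" unfolding I_def by (rule submod_w_op[OF sB])
  have "w_op R I = I" unfolding I_def by (rule w_op_idem[OF sB])
  then have wI: "w_ideal R I" using sI oneB BI by (auto simp: w_ideal_def intro!: nz_submodI[of _ _ 1])
  have xI: "x * i \<in> R" if "i \<in> I" for i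
  proof (rule mem_ring_locally)
    fix M assume M: "t_max R M"
    then obtain s where s: "s \<in> R - M" "s * i \<in> B" using \<open>i \<in> I\<close> by (auto simp: I_def mem_w_op mem_localize_t_max)
    then have "s * (x * i) \<in> R" using xB[OF s(2)] by (simp add: ac_simps)
    then show "x * i \<in> localize R M R" using s(1) by (auto intro: localizeI[OF M])
  qed
  \<comment> \<open>At M only the summand (R : M) is nontrivial, and m clears it; so m B is locally
    integral.\<close>
  have Bin: "m * b \<in> localize R M R" if M: "M \<in> X" and m: "m \<in> M" and b: "b \<in> B" for m M b
    using b unfolding B_def
  proof (induction rule: smod_prod_induct)
    case zero
    then show ?case using localize_superset[OF loc, of M R] M X by auto
  next
    case (add b c)
    then show ?case using localize_add[OF loc submod_self, of M] M X by (simp add: distrib_left)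
  next
    case (mult a b)
    have tM: "t_max R M" using M X by simp
    note RV = localize_superset[OF loc[OF tM], of R]
    obtain M' where M': "M' \<in> X" "b \<in> colon R M'" using mult(2) by blast
    have "m * b \<in> localize R M R"
    proof (cases "M' = M")
      case True
      then show ?thesis using colonD[OF M'(2), of m] m RV by (auto simp: mult.commute)
    next
      case False
      then have "b \<in> localize R M R" using other[of M' M b] M' X tM by simp
      then show ?thesis
        using localize_smult[OF loc[OF tM] submod_self] m t_max_ideal(2)[OF tM] RV by blast
    qed
    then have "a * (m * b) \<in> localize R M R"
      using localize_smult[OF loc[OF tM] submod_self] mult(1) RV by blast
    then show ?case by (simp add: ac_simps)
  qed
  \<comment> \<open>An element of B involves finitely many of the summands and is integral away from
    the corresponding t-maximal ideals.\<close>
  have Bfin: "\<exists>F. finite F \<and> F \<subseteq> X \<and> (\<forall>M. t_max R M \<and> M \<notin> F \<longrightarrow> b \<in> localize R M R)" if "b \<in> B" for b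
    using that unfolding B_def
  proof (induction rule: smod_prod_induct)
    case zero
    then show ?case using subsetD[OF localize_superset[OF loc] zero_mem] by (intro exI[of _ "{}"]) auto
  next
    case (add b c)
    then obtain F G where "finite F" "F \<subseteq> X" "\<forall>M. t_max R M \<and> M \<notin> F \<longrightarrow> b \<in> localize R M R"
      "finite G" "G \<subseteq> X" "\<forall>M. t_max R M \<and> M \<notin> G \<longrightarrow> c \<in> localize R M R" by blast
    then show ?case using localize_add[OF loc submod_self] by (intro exI[of _ "F \<union> G"]) auto
  next
    case (mult a b)
    then obtain M' where M': "M' \<in> X" "b \<in> colon R M'" by blast
    have "a * b \<in> localize R M R" if "t_max R M" "M \<noteq> M'" for M
      using other[of M' M b] M' X that localize_smult[OF loc submod_self, of M a b] mult(1)
        localize_superset[OF loc, of M R] by auto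
    then show ?case using M' by (intro exI[of _ "{M'}"]) auto
  qed
  have Ifin: "\<exists>F. finite F \<and> (\<forall>M. t_max R M \<and> M \<notin> F \<longrightarrow> i \<in> localize R M R)" if "i \<in> I" for i
  proof -
    obtain S where S: "finite S" "S \<subseteq> R" "\<exists>s\<in>S. s \<noteq> 0" "\<And>y. \<forall>s\<in>S. y * s \<in> R \<Longrightarrow> y \<in> R"
        "\<And>s. s \<in> S \<Longrightarrow> s * i \<in> B"
      using w_op_t_unit[OF sB, of i] \<open>i \<in> I\<close> unfolding I_def by metis
    have "\<forall>s\<in>S. \<exists>F. finite F \<and> (\<forall>M. t_max R M \<and> M \<notin> F \<longrightarrow> s * i \<in> localize R M R)"
      using Bfin[OF S(5)] by blast
    then obtain F where F: "\<And>s. s \<in> S \<Longrightarrow> finite (F s)"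
      "\<And>s M. s \<in> S \<Longrightarrow> t_max R M \<Longrightarrow> M \<notin> F s \<Longrightarrow> s * i \<in> localize R M R" by metis
    have "i \<in> localize R M R" if M: "t_max R M" "M \<notin> \<Union>(F ` S)" for M
    proof -
      obtain s where s: "s \<in> S" "s \<notin> M" using t_unit_not_subset[OF M(1) S(1,3,4)] by blast
      have "s * i \<in> localize R M R" using F(2)[OF s(1) M(1)] M(2) s(1) by blast
      moreover have "s \<in> R - M" using s S(2) by blast
      ultimately show ?thesis using localize_div[OF loc[OF M(1)] submod_self] by blast
    qed
    then show ?thesis using S(1) F(1) by (intro exI[of _ "\<Union>(F ` S)"]) auto
  qed
  \<comment> \<open>At M in X, multiply y by z in (R : M), use that y z stays in I, and clear with
    m; since m z is a unit at M, y is integral there. Outside X all of B is integral.\<close>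
  have EI: "Eend I \<subseteq> R"
  proof
    fix y assume y: "y \<in> Eend I"
    show "y \<in> R"
    proof (rule mem_ring_locally)
      fix M assume M: "t_max R M"
      show "y \<in> localize R M R"
      proof (cases "M \<in> X")
        case True
        obtain m z where mz: "m \<in> M" "z \<in> colon R M" "m * z \<in> R - M"
          using t_invertible_t_max[OF M inv[OF M]] by blast
        have "y * z \<in> I" using EendD[OF y] mz(2) colB[OF True] BI by blast
        then obtain s where s: "s \<in> R - M" "s * (y * z) \<in> B"
          using M by (auto simp: I_def mem_w_op mem_localize_t_max)
        have "m * (s * (y * z)) \<in> localize R M R" by (rule Bin[OF True mz(1) s(2)])
        then have "(m * z) * (s * y) \<in> localize R M R" by (simp add: ac_simps)
        then show ?thesis
          by (rule localize_div[OF loc[OF M] submod_self s(1) localize_div[OF loc[OF M] submod_self mz(3)]])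
      next
        case False
        have "y \<in> I" using EendD[OF y, of 1] oneB BI by auto
        then obtain s where s: "s \<in> R - M" "s * y \<in> B"
          using M by (auto simp: I_def mem_w_op mem_localize_t_max)
        have "s * y \<in> localize R M R" using Bfin[OF s(2)] M False by blast
        then show ?thesis by (rule localize_div[OF loc[OF M] submod_self s(1)])
      qed
    qed
  qed
  define C where "C = colon (Eend I) I"
  have CI: "c * i \<in> R" if "c \<in> C" "i \<in> I" for c i
    using colonD[of c "Eend I" I i] that EI by (auto simp: C_def)
  have G: "\<exists>s\<in>smod_prod I C. s \<notin> M" if "t_max R M" for M
    using w_stable_domainD[OF st wI x(2) xI that] by (auto simp: C_def)
  have sG: "submod R (smod_prod I C)" by (rule submod_smod_prod[OF sI])
  obtain M1 where "t_max R M1" using ex_t_max by blast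
  with G obtain s where "s \<in> smod_prod I C" "s \<notin> M1" by blast
  then have nzG: "nz_submod R (smod_prod I C)"
    using submod_zero[OF t_max_submod[OF \<open>t_max R M1\<close>]] by (intro nz_submodI[OF sG]) auto
  have GR: "smod_prod I C \<subseteq> R"
    by (rule smod_prod_subset[OF submod_self]) (metis CI mult.commute)
  obtain S where S: "finite S" "S \<subseteq> smod_prod I C" "\<exists>s\<in>S. s \<noteq> 0" "\<And>y. \<forall>s\<in>S. y * s \<in> R \<Longrightarrow> y \<in> R"
    using t_unit_finite[OF nzG GR G] by metis
  \<comment> \<open>For a product a c with c in C, the set c I lies in R and the single element a is
    integral almost everywhere; finite sums keep this property.\<close>
  have "\<exists>F. finite F \<and> (\<forall>M. t_max R M \<and> M \<notin> F \<longrightarrow> (\<forall>i\<in>I. g * i \<in> localize R M R))"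
    if "g \<in> smod_prod I C" for g
    using that
  proof (induction rule: smod_prod_induct)
    case zero
    then show ?case using subsetD[OF localize_superset[OF loc] zero_mem] by (intro exI[of _ "{}"]) auto
  next
    case (add b c)
    then obtain F G where "finite F" "\<forall>M. t_max R M \<and> M \<notin> F \<longrightarrow> (\<forall>i\<in>I. b * i \<in> localize R M R)"
      "finite G" "\<forall>M. t_max R M \<and> M \<notin> G \<longrightarrow> (\<forall>i\<in>I. c * i \<in> localize R M R)" by blast
    then show ?case
      using localize_add[OF loc submod_self] by (intro exI[of _ "F \<union> G"]) (auto simp: distrib_right)
  next
    case (mult a c)
    obtain F where F: "finite F" "\<And>M. t_max R M \<Longrightarrow> M \<notin> F \<Longrightarrow> a \<in> localize R M R"
      using Ifin[OF mult(1)] by blast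
    have "a * c * i \<in> localize R M R" if "t_max R M" "M \<notin> F" "i \<in> I" for M i
    proof -
      have "c * i \<in> localize R M R"
        using CI[OF mult(2) that(3)] localize_superset[OF loc[OF that(1)], of R] by blast
      from localize_smult[OF loc[OF that(1)] submod_self F(2)[OF that(1,2)] this]
      show ?thesis by (simp add: mult.assoc)
    qed
    then show ?case using F(1) by blast
  qed
  then have "\<forall>s\<in>S. \<exists>F. finite F \<and> (\<forall>M. t_max R M \<and> M \<notin> F \<longrightarrow> (\<forall>i\<in>I. s * i \<in> localize R M R))"
    using S(2) by blast
  then obtain F where F: "\<And>s. s \<in> S \<Longrightarrow> finite (F s)"
    "\<And>s M i. s \<in> S \<Longrightarrow> t_max R M \<Longrightarrow> M \<notin> F s \<Longrightarrow> i \<in> I \<Longrightarrow> s * i \<in> localize R M R" by metis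
  have "finite (\<Union>(F ` S))" using S(1) F(1) by blast
  \<comment> \<open>This M in X avoids all exceptional sets, so z in (R : M) would be integral at M.
    But then t z in R sends m into M, although t (m z) is outside M.\<close>
  then obtain M where M: "M \<in> X" "M \<notin> \<Union>(F ` S)" using infX by (meson finite_subset subsetI)
  then have tM: "t_max R M" by (simp add: X)
  obtain s where s: "s \<in> S" "s \<notin> M" using t_unit_not_subset[OF tM S(1,3,4)] by blast
  obtain m z where mz: "m \<in> M" "z \<in> colon R M" "m * z \<in> R - M"
    using t_invertible_t_max[OF tM inv[OF tM]] by blast
  have "z \<in> I" using mz(2) colB[OF M(1)] BI by blast
  then have "s * z \<in> localize R M R" using F(2)[OF s(1) tM] M(2) s(1) by blast
  then have "z \<in> localize R M R"
    by (rule localize_div[OF loc[OF tM] submod_self, of s, rotated]) (use s S(2) GR in blast)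
  then obtain t where t: "t \<in> R - M" "t * z \<in> R" by (auto simp: mem_localize_t_max[OF tM])
  have "(t * z) * m \<in> M" by (rule submod_smult[OF t_max_submod[OF tM] t(2) mz(1)])
  then have "t * (m * z) \<in> M" by (simp add: ac_simps)
  then show False using t_max_complement(2)[OF tM t(1) mz(3)] by blast
qed

section \<open>Strongly discrete PvMDs\<close>

text \<open>P P (E(P) : P) lies in P. If P is locally equal to P P, the product P (E(P) : P) is
  locally inside P, and so inside every t-maximal ideal above P, contrary to stability.\<close>

lemma w_stable_prime_not_idempotent:
  assumes pvmd: "PvMD R" and P: "t_prime R P" and st: "w_stable_ideal R P"
  shows "t_op R (smod_prod P P) \<noteq> P"
proof
  assume idem: "t_op R (smod_prod P P) = P"
  have tP: "t_ideal R P" and pP: "prime_ideal R P" using P by (auto simp: t_prime_def)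
  note sP = prime_submod[OF pP] and PR = prime_subset[OF pP]
  have "1 \<notin> t_op R P" using tP prime_complement(1)[OF pP] by (simp add: t_ideal_def)
  then obtain M where M: "t_max R M" "P \<subseteq> M"
    using ex_t_max_superset[OF t_ideal_nz[OF tP] PR] by blast
  obtain z where z: "z \<in> P" "z \<noteq> 0" using t_ideal_nz[OF tP] by (rule nz_submodE)
  have "nz_submod R (smod_prod P P)"
    using submod_smod_prod[OF sP, of P] smod_prod_mult[OF z(1) z(1)] z(2)
    by (intro nz_submodI[of _ _ "z * z"]) auto
  then have idem': "w_op R (smod_prod P P) = P"
    using PvMD_t_op_eq_w_op[OF pvmd] idem by blast
  have prod: "u * x \<in> P" if "u \<in> smod_prod P P" "x \<in> colon (Eend P) P" for u x
    using that(1)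
  proof (induction rule: smod_prod_induct)
    case (mult a b)
    then show ?case using EendD[OF colonD[OF that(2) mult(2)] mult(1)] by (simp add: ac_simps)
  qed (auto simp: distrib_right intro: submod_zero[OF sP] submod_add[OF sP])
  obtain s where s: "s \<in> R - M" "s \<in> smod_prod P (colon (Eend P) P)"
    using w_stable_idealD[OF st M(1)] by blast
  from s(2) have "s \<in> localize R M P"
  proof (induction rule: smod_prod_induct)
    case zero
    then show ?case using submod_zero[OF sP] localize_superset[OF t_max_prime[OF M(1)], of P] by blast
  next
    case (add a b)
    then show ?case by (rule localize_add[OF t_max_prime[OF M(1)] sP])
  next
    case (mult p x)
    then have "p \<in> w_op R (smod_prod P P)" using idem' by simp
    then obtain t where t: "t \<in> R - M" "t * p \<in> smod_prod P P"
      using M(1) by (auto simp: mem_w_op mem_localize_t_max)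
    then show ?case using prod[OF t(2) mult(2)] by (intro localizeI[OF M(1), of t]) (auto simp: mult.assoc)
  qed
  then obtain t where "t \<in> R - M" "t * s \<in> M" using M by (auto simp: mem_localize_t_max)
  then show False using t_max_complement(2)[OF M(1) _ s(1)] by blast
qed

text \<open>This says that Q has an element which is not a product of two elements of Q. Otherwise
  the contraction P of Q to R, a t-prime, would satisfy P = (P P)_w = (P P)_t.\<close>

lemma strongly_discrete_local:
  assumes sd: "strongly_discrete_PvMD R" and M: "t_max R M"
    and Q: "prime_ideal (localize R M R) Q" and z: "z \<in> Q" "z \<noteq> 0"
  shows "\<exists>q\<in>Q. q \<noteq> 0 \<and> (\<forall>b\<in>Q. b \<noteq> 0 \<longrightarrow> q / b \<notin> Q)"
proof (rule ccontr)
  assume neg: "\<not> ?thesis"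
  let ?V = "localize R M R"
  have pvmd: "PvMD R" using sd by (simp add: strongly_discrete_PvMD_def)
  interpret V: field_subring ?V
    by unfold_locales (rule is_subring_localize[OF t_max_prime[OF M]])
  note RV = localize_superset[OF t_max_prime[OF M], of R]
  note sQ = V.prime_submod[OF Q] and QV = V.prime_subset[OF Q]
  have Q1: "1 \<notin> Q" using V.prime_complement(1)[OF Q] by blast
  have divQ: "x \<in> Q" if "s \<in> R - M" "s * x \<in> Q" for s x
    using submod_smult[OF sQ inverse_mem_localize[OF t_max_prime[OF M] that(1)] that(2)]
      t_max_complement(3)[OF M that(1)] by (simp add: mult.assoc[symmetric])
  define P where "P = Q \<inter> R"
  have denom: "\<exists>s\<in>R - M. s * x \<in> P" if "x \<in> Q" for x
  proof -
    obtain s where s: "s \<in> R - M" "s * x \<in> R" using QV \<open>x \<in> Q\<close> mem_localize_t_max[OF M] by blast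
    moreover have "s * x \<in> Q" using submod_smult[OF sQ] s RV \<open>x \<in> Q\<close> by blast
    ultimately show ?thesis by (auto simp: P_def)
  qed
  have sP: "submod R P"
    unfolding P_def using submod_zero[OF sQ] submod_add[OF sQ] submod_smult[OF sQ] RV
    by (intro submodI) (auto intro: add_mem mult_mem)
  have PR: "P \<subseteq> R" by (simp add: P_def)
  have pP: "prime_ideal R P"
    unfolding prime_ideal_def r_ideal_def
  proof (intro conjI ballI impI)
    show "P \<noteq> R" using Q1 one_mem unfolding P_def by blast
    fix a b assume "a \<in> R" "b \<in> R" "a * b \<in> P"
    then show "a \<in> P \<or> b \<in> P" using Q RV unfolding prime_ideal_def P_def by blast
  qed (use sP PR in auto)
  obtain s0 where "s0 \<in> R - M" "s0 * z \<in> P" using denom[OF z(1)] by blast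
  then have nzP: "nz_submod R P" using t_max_complement(3)[OF M] z by (intro nz_submodI[OF sP, of "s0 * z"]) auto
  have "t_op R P \<subseteq> P"
    unfolding PvMD_t_op_eq_w_op[OF pvmd nzP]
  proof
    fix x assume x: "x \<in> w_op R P"
    then have "x \<in> R" using w_op_mono[OF PR] w_op_ring by blast
    moreover obtain s where "s \<in> R - M" "s * x \<in> P" using x M by (auto simp: mem_w_op mem_localize_t_max)
    ultimately show "x \<in> P" using divQ by (auto simp: P_def)
  qed
  then have tP: "t_ideal R P" using nzP PR by (simp add: integral_t_ideal_iff)
  then have "t_op R (smod_prod P P) \<noteq> P"
    using sd pP by (simp add: strongly_discrete_PvMD_def t_prime_def)
  moreover have "t_op R (smod_prod P P) = P"
  proof
    have sub: "smod_prod P P \<subseteq> P"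
      by (rule smod_prod_subset[OF sP]) (use submod_smult[OF sP] PR in blast)
    show "t_op R (smod_prod P P) \<subseteq> P"
      using t_op_mono[OF sub] tP by (simp add: t_ideal_def)
    obtain y where y: "y \<in> P" "y \<noteq> 0" using nzP by (rule nz_submodE)
    have nzPP: "nz_submod R (smod_prod P P)"
      using submod_smod_prod[OF sP, of P] smod_prod_mult[OF y(1) y(1)] y(2)
      by (intro nz_submodI[of _ _ "y * y"]) auto
    have "P \<subseteq> w_op R (smod_prod P P)"
    proof
      fix p assume p: "p \<in> P"
      show "p \<in> w_op R (smod_prod P P)"
        unfolding mem_w_op
      proof (intro allI impI)
        fix M' assume M': "t_max R M'"
        consider "p = 0" | "p \<noteq> 0" "\<not> P \<subseteq> M'" | "p \<noteq> 0" "P \<subseteq> M'" by blast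
        then show "p \<in> localize R M' (smod_prod P P)"
        proof cases
          case 1
          then show ?thesis
            using smod_prod_zero localize_superset[OF t_max_prime[OF M']] by blast
        next
          case 2
          then obtain s where "s \<in> P" "s \<notin> M'" by blast
          then show ?thesis
            using smod_prod_mult[OF _ p, of s P] PR by (intro localizeI[OF M', of s]) auto
        next
          case 3
          have "p \<in> Q" using p by (simp add: P_def)
          then obtain b where b: "b \<in> Q" "b \<noteq> 0" "p / b \<in> Q" using neg 3 by blast
          obtain s t where s: "s \<in> R - M" "s * b \<in> P" and t: "t \<in> R - M" "t * (p / b) \<in> P"
            using denom[OF b(1)] denom[OF b(3)] by blast
          have st: "s * t \<in> R - M" using t_max_complement(2)[OF M s(1) t(1)] .
          then have st0: "s * t \<noteq> 0" using t_max_complement(3)[OF M] by blast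
          have "s * t \<notin> P"
          proof
            assume "s * t \<in> P"
            then have "s * t * 1 \<in> Q" by (simp add: P_def)
            then show False using divQ[OF st] Q1 by blast
          qed
          \<comment> \<open>The factorization p = b (p / b) holds over R_M and has to be moved to
            M'. As P is prime, s t is outside P and the valuation ring R_M' makes it divide the
            element s b of P; so the factors can be rewritten with denominators outside M'.\<close>
          have "s * b / (s * t) \<in> localize R M' R"
          proof (rule ccontr)
            assume "\<not> ?thesis"
            then have "s * t / (s * b) \<in> localize R M' R"
              using valuation_domD[OF PvMD_valuation[OF pvmd M']] by blast
            then obtain s' where s': "s' \<in> R - M'" "s' * (s * t / (s * b)) \<in> R"
              by (auto simp: mem_localize_t_max[OF M'])
            have "s' * (s * t / (s * b)) * (s * b) \<in> P"
              by (rule submod_smult[OF sP s'(2) s(2)])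
            then have "s' * (s * t) \<in> P" using st0 b(2) by (simp add: mult.commute[of t s])
            then have "s' \<in> P \<or> s * t \<in> P" using pP s'(1) st unfolding prime_ideal_def by blast
            then show False using \<open>s * t \<notin> P\<close> s'(1) 3 by blast
          qed
          then obtain s' where s': "s' \<in> R - M'" "s' * (s * b / (s * t)) \<in> R" (is "?r \<in> R")
            by (auto simp: mem_localize_t_max[OF M'])
          have "s * t * ?r = s' * (s * b)" using st0 by simp
          then have "s * t * ?r \<in> P" using submod_smult[OF sP _ s(2), of s'] s'(1) by (metis DiffD1)
          then have "?r \<in> P" using pP s'(2) st \<open>s * t \<notin> P\<close> unfolding prime_ideal_def by blast
          then have "?r * (t * (p / b)) \<in> smod_prod P P" using t(2) by (rule smod_prod_mult)
          moreover have "?r * (t * (p / b)) = s' * p" using st0 b(2) by simp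
          ultimately show ?thesis using s'(1) by (intro localizeI[OF M']) auto
        qed
      qed
    qed
    then show "P \<subseteq> t_op R (smod_prod P P)" using w_op_subset_t_op[OF nzPP] by blast
  qed
  ultimately show False by blast
qed

text \<open>A non-idempotent prime Q, attached to J, supplies q outside the products of Q with
  itself; an element a of J with a / q outside J is then a generator over E(J).\<close>

lemma strongly_discrete_locally_principal:
  assumes sd: "strongly_discrete_PvMD R" and M: "t_max R M"
    and nzJ: "nz_submod (localize R M R) J" and JV: "J \<subseteq> localize R M R"
  shows "\<exists>a\<in>J. a \<noteq> 0 \<and> (\<forall>b\<in>J. b / a \<in> Eend J)"
proof -
  let ?V = "localize R M R"
  have pvmd: "PvMD R" using sd by (simp add: strongly_discrete_PvMD_def)
  note val = valuation_domD[OF PvMD_valuation[OF pvmd M]]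
  interpret V: field_subring ?V
    by unfold_locales (rule is_subring_localize[OF t_max_prime[OF M]])
  note RV = localize_superset[OF t_max_prime[OF M], of R]
  note sJ = nz_submod_submod[OF nzJ]
  note VE = ring_subset_Eend[OF sJ]
  \<comment> \<open>E(J) is the localization of V at the prime of those v with v J \<noteq> J.\<close>
  define Q where "Q = {v \<in> ?V. v = 0 \<or> (\<exists>j\<in>J. j / v \<notin> J)}"
  have mulQ: "r * v \<in> Q" if r: "r \<in> ?V" and v: "v \<in> Q" for r v
  proof (cases "r * v = 0")
    case False
    then obtain j where j: "j \<in> J" "j / v \<notin> J" using v by (auto simp: Q_def)
    have "r * (j / (r * v)) = j / v" using False by simp
    then have "j / (r * v) \<notin> J" using j(2) submod_smult[OF sJ r] by metis
    then show ?thesis using j(1) V.mult_mem r v by (auto simp: Q_def)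
  qed (use V.zero_mem in \<open>auto simp: Q_def\<close>)
  have notQ: "inverse v \<in> Eend J" if "v \<in> ?V" "v \<notin> Q" for v
    using that by (intro EendI) (auto simp: Q_def divide_inverse mult.commute)
  have sQ: "submod ?V Q"
  proof (rule submodI)
    show "0 \<in> Q" by (simp add: Q_def)
    fix v w assume vw: "v \<in> Q" "w \<in> Q"
    consider "v = 0" | "w = 0" | "v \<noteq> 0" "w / v \<in> ?V" | "w \<noteq> 0" "v / w \<in> ?V"
      using val[of v w] by blast
    then show "v + w \<in> Q"
    proof cases
      case 3
      have "(1 + w / v) * v \<in> Q" using 3 vw by (intro mulQ V.add_mem) auto
      then show ?thesis using 3 by (simp add: distrib_right)
    next
      case 4
      have "(v / w + 1) * w \<in> Q" using 4 vw by (intro mulQ V.add_mem) auto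
      then show ?thesis using 4 by (simp add: distrib_right)
    qed (use vw in auto)
  qed (rule mulQ)
  have Q1: "1 \<notin> Q" by (simp add: Q_def)
  have pQ: "prime_ideal ?V Q"
    unfolding prime_ideal_def r_ideal_def
  proof (intro conjI ballI impI)
    show "Q \<subseteq> ?V" by (auto simp: Q_def)
    show "Q \<noteq> ?V" using Q1 V.one_mem by blast
    fix v w assume vw: "v \<in> ?V" "w \<in> ?V" "v * w \<in> Q"
    show "v \<in> Q \<or> w \<in> Q"
    proof (rule ccontr)
      assume "\<not> (v \<in> Q \<or> w \<in> Q)"
      then have nQ: "v \<notin> Q" "w \<notin> Q" by auto
      then have n: "v \<noteq> 0" "w \<noteq> 0" "inverse v * inverse w \<in> Eend J"
        using Eend_mult[OF notQ notQ] vw submod_zero[OF sQ] by auto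
      then have "j / (v * w) \<in> J" if "j \<in> J" for j
        using EendD[OF n(3) that] by (simp add: divide_inverse ac_simps)
      then show False using vw(3) n by (auto simp: Q_def)
    qed
  qed (rule sQ)
  obtain j where j: "j \<in> J" "j \<noteq> 0" using nzJ by (rule nz_submodE)
  obtain m where m: "m \<in> M" "m \<noteq> 0" using t_ideal_nz[OF t_max_ideal(1)[OF M]] by (rule nz_submodE)
  \<comment> \<open>This makes Q nonzero: j / (m j) = 1 / m is outside R_M, hence outside J, so m j
    belongs to Q.\<close>
  have "inverse m \<notin> ?V"
  proof
    assume "inverse m \<in> ?V"
    then obtain s where s: "s \<in> R - M" "s * inverse m \<in> R" by (auto simp: mem_localize_t_max[OF M])
    have "s * inverse m * m \<in> M" by (rule submod_smult[OF t_max_submod[OF M] s(2) m(1)])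
    then show False using s(1) m by (simp add: mult.assoc)
  qed
  then have "j / (m * j) \<notin> J" using JV j(2) by (auto simp: inverse_eq_divide)
  moreover have "m * j \<in> ?V" using m(1) t_max_ideal(2)[OF M] RV JV j(1) by (intro V.mult_mem) auto
  ultimately have "m * j \<in> Q" using j unfolding Q_def by blast
  moreover have "m * j \<noteq> 0" using j m(2) by simp
  ultimately obtain q where q: "q \<in> Q" "q \<noteq> 0" "\<And>b. b \<in> Q \<Longrightarrow> b \<noteq> 0 \<Longrightarrow> q / b \<notin> Q"
    using strongly_discrete_local[OF sd M pQ] by blast
  then obtain a where a: "a \<in> J" "a / q \<notin> J" by (auto simp: Q_def)
  have a0: "a \<noteq> 0" using a(2) submod_zero[OF sJ] by auto
  \<comment> \<open>If b / a is not in E(J), then c = a / b lies in Q. As q is not c times an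
    element of Q, the quotient c / q is in E(J), and (c / q) b = a / q would be in J.\<close>
  have "b / a \<in> Eend J" if b: "b \<in> J" for b
  proof (rule ccontr)
    assume nE: "b / a \<notin> Eend J"
    then have b0: "b \<noteq> 0" using subsetD[OF VE V.zero_mem] by auto
    have "b / a \<notin> ?V" using nE VE by blast
    then have c: "a / b \<in> ?V" using val[of b a] by blast
    have cQ: "a / b \<in> Q" using notQ[OF c] nE by (auto simp: field_simps)
    have c0: "a / b \<noteq> 0" using a0 b0 by simp
    have "(a / b) / q \<in> Eend J"
    proof (cases "(a / b) / q \<in> ?V")
      case False
      then have "q / (a / b) \<in> ?V" using val by blast
      then have "inverse (q / (a / b)) \<in> Eend J" using notQ q(3)[OF cQ c0] by blast
      then show ?thesis by (simp add: mult.commute[of b q])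
    qed (use VE in blast)
    from EendD[OF this b] show False using a(2) b0 by simp
  qed
  then show ?thesis using a(1) a0 by blast
qed

lemma strongly_discrete_t_finite_imp_w_stable:
  assumes sd: "strongly_discrete_PvMD R" and fc: "t_finite_char R"
  shows "w_stable_domain R"
  unfolding w_stable_domain_def
proof (intro allI impI, elim conjE)
  fix I assume IR: "I \<subseteq> R" and wI: "w_ideal R I"
  have pvmd: "PvMD R" using sd by (simp add: strongly_discrete_PvMD_def)
  have nzI: "nz_submod R I" using wI by (simp add: w_ideal_def)
  note sI = nz_submod_submod[OF nzI]
  obtain x where x: "x \<in> I" "x \<noteq> 0" using nzI by (rule nz_submodE)
  have loc: "\<exists>a\<in>I. a \<noteq> 0 \<and> (\<forall>b\<in>I. b / a \<in> Eend (localize R M I))" if M: "t_max R M" for M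
  proof -
    note pM = t_max_prime[OF M]
    let ?J = "localize R M I"
    have sJ: "submod (localize R M R) ?J" by (rule submod_localize[OF pM sI])
    have IJ: "I \<subseteq> ?J" by (rule localize_superset[OF pM])
    have "nz_submod (localize R M R) ?J" using sJ x IJ by (blast intro: nz_submodI)
    moreover have "?J \<subseteq> localize R M R" using IR by (fastforce simp: mem_localize[OF pM])
    ultimately obtain a where a: "a \<in> ?J" "a \<noteq> 0" "\<forall>b\<in>?J. b / a \<in> Eend ?J"
      using strongly_discrete_locally_principal[OF sd M] by blast
    obtain s where s: "s \<in> R - M" "s * a \<in> I" using a(1) by (auto simp: mem_localize[OF pM])
    have "b / (s * a) \<in> Eend ?J" if "b \<in> I" for b
    proof -
      have "inverse s * (b / a) \<in> Eend ?J"
        using a(3) IJ that inverse_mem_localize[OF pM s(1)] ring_subset_Eend[OF sJ]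
        by (intro Eend_mult) auto
      then show ?thesis by (simp add: field_simps)
    qed
    then show ?thesis
      using s a(2) prime_complement(3)[OF pM s(1)] by (intro bexI[of _ "s * a"]) auto
  qed
  then obtain a where a: "\<And>M. t_max R M \<Longrightarrow> a M \<in> I \<and> a M \<noteq> 0 \<and> (\<forall>b\<in>I. b / a M \<in> Eend (localize R M I))"
    by metis
  \<comment> \<open>One local generator for each of the finitely many t-maximal ideals containing x,
    together with x itself, which is a unit at all the others.\<close>
  define F where "F = insert x (a ` {M. t_max R M \<and> x \<in> M})"
  have finF: "finite F" unfolding F_def using fc x IR by (auto simp: t_finite_char_def)
  have FI: "F \<subseteq> I" unfolding F_def using x a by auto
  \<comment> \<open>At M containing x, y a_M is in R and b / a_M is a local endomorphism, so y b is
    one too. At the other M, y x is in R and x is an admissible denominator.\<close>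
  have col: "y \<in> colon (Eend I) I" if y: "y \<in> colon R F" for y
  proof (intro colonI Eend_w_idealI[OF wI])
    fix b c M assume b: "b \<in> I" and M: "t_max R M" and c: "c \<in> I"
    note pM = t_max_prime[OF M]
    note RV = localize_superset[OF pM, of R] and IJ = localize_superset[OF pM, of I]
    show "y * b * c \<in> localize R M I"
    proof (cases "x \<in> M")
      case True
      then have "y * a M \<in> R" using M by (intro colonD[OF y]) (auto simp: F_def)
      moreover have "b / a M * c \<in> localize R M I"
        using a[OF M] b c IJ by (intro EendD[of _ "localize R M I"]) auto
      ultimately have "y * a M * (b / a M * c) \<in> localize R M I"
        using localize_smult[OF pM sI] RV by blast
      then show ?thesis using a[OF M] by (simp add: field_simps)
    next
      case False
      have "y * x \<in> R" by (intro colonD[OF y]) (simp add: F_def)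
      then have "(y * x) * (b * c) \<in> I"
        using submod_smult[OF sI] b c IR by blast
      then have "x * (y * b * c) \<in> I" by (simp add: ac_simps)
      then show ?thesis using False x IR by (intro localizeI[OF M, of x]) auto
    qed
  qed
  show "w_stable_ideal R I"
  proof (rule w_stable_idealI[OF wI])
    fix M assume M: "t_max R M"
    have "\<exists>s\<in>F. s \<noteq> 0" using x by (auto simp: F_def)
    then obtain c y where "c \<in> F" "y \<in> colon R F" "c * y \<in> R - M"
      using PvMD_finite_invertible[OF pvmd M finF] by blast
    then show "\<exists>s\<in>R - M. s \<in> smod_prod I (colon (Eend I) I)"
      using smod_prod_mult[of c I y "colon (Eend I) I"] FI col by blast
  qed
qed

text \<open>Fix a nonzero x in the first ideal. At each M containing x the chain becomes stationary,
  there are finitely many such M, and at the others x is a unit, so every member is trivial.\<close>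

lemma strongly_discrete_t_finite_imp_acc:
  assumes sd: "strongly_discrete_PvMD R" and fc: "t_finite_char R"
  shows "acc_radical_t R"
  unfolding acc_radical_t_def
proof (intro allI impI, elim conjE)
  fix f :: "nat \<Rightarrow> 'a set"
  assume f: "\<forall>n. f n \<subseteq> R \<and> t_ideal R (f n) \<and> radical_ideal R (f n)" and inc: "\<forall>n. f n \<subseteq> f (Suc n)"
  have pvmd: "PvMD R" using sd by (simp add: strongly_discrete_PvMD_def)
  have mono: "f m \<subseteq> f n" if "m \<le> n" for m n
    by (rule lift_Suc_mono_le[OF _ that]) (use inc in blast)
  have fR: "f n \<subseteq> R" and tf: "t_ideal R (f n)" for n using f by auto
  have sf: "submod R (f n)" for n by (rule nz_submod_submod[OF t_ideal_nz[OF tf]])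
  have rad: "y \<in> f n" if "y \<in> R" "y\<^sup>2 \<in> f n" for y n
  proof -
    have "f n = {x \<in> R. \<exists>k. x ^ k \<in> f n}" using f unfolding radical_ideal_def by blast
    then show ?thesis using that by blast
  qed
  obtain x where x: "x \<in> f 0" "x \<noteq> 0" using t_ideal_nz[OF tf[of 0]] by (rule nz_submodE)
  have loc: "\<exists>N. \<forall>n. f n \<subseteq> localize R M (f N)" if M: "t_max R M" for M
  proof -
    let ?V = "localize R M R"
    note pM = t_max_prime[OF M]
    note RV = localize_superset[OF pM, of R]
    interpret V: field_subring ?V by unfold_locales (rule is_subring_localize[OF pM])
    note val = valuation_domD[OF PvMD_valuation[OF pvmd M]]
    define U where "U = (\<Union>n. f n)"
    have sU: "submod R U"
      unfolding U_def
    proof (rule submodI)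
      fix a b assume "a \<in> (\<Union>n. f n)" "b \<in> (\<Union>n. f n)"
      then obtain k l where "a \<in> f k" "b \<in> f l" by blast
      then have "a \<in> f (max k l)" "b \<in> f (max k l)" using mono[of k "max k l"] mono[of l "max k l"] by auto
      then show "a + b \<in> (\<Union>n. f n)" using submod_add[OF sf] by blast
    qed (use submod_zero[OF sf] submod_smult[OF sf] in blast)+
    define Q where "Q = localize R M U"
    have sQ: "submod ?V Q" unfolding Q_def by (rule submod_localize[OF pM sU])
    have memQ: "y \<in> Q \<longleftrightarrow> (\<exists>n. \<exists>s\<in>R - M. s * y \<in> f n)" for y
      by (auto simp: Q_def U_def mem_localize[OF pM])
    have fQ: "f n \<subseteq> Q" for n
      using localize_superset[OF pM, of U] by (auto simp: Q_def U_def)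
    show ?thesis
    proof (cases "1 \<in> Q")
      case True
      then obtain N s where s: "s \<in> R - M" "s \<in> f N" using memQ by auto
      have "f n \<subseteq> localize R M (f N)" for n
      proof
        fix y assume "y \<in> f n"
        then have "y * s \<in> f N" using fR submod_smult[OF sf _ s(2)] by blast
        then show "y \<in> localize R M (f N)" using s(1) by (intro localizeI[OF M, of s]) (auto simp: mult.commute)
      qed
      then show ?thesis by blast
    next
      case False
      \<comment> \<open>The union of the chain stays radical in R_M, and a proper radical ideal of a
        valuation domain is prime.\<close>
      have sqQ: "a \<in> Q" if "a \<in> ?V" "a\<^sup>2 \<in> Q" for a
      proof -
        obtain n s where s: "s \<in> R - M" "s * a\<^sup>2 \<in> f n" using \<open>a\<^sup>2 \<in> Q\<close> memQ by blast
        obtain t where t: "t \<in> R - M" "t * a \<in> R" using \<open>a \<in> ?V\<close> mem_localize[OF pM] by blast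
        have "(s * t\<^sup>2) * (s * a\<^sup>2) \<in> f n"
          by (rule submod_smult[OF sf _ s(2)]) (use s t in \<open>auto intro: mult_mem power_mem\<close>)
        then have "(s * (t * a))\<^sup>2 \<in> f n" by (simp add: power2_eq_square ac_simps)
        moreover have "s * (t * a) \<in> R" using s t mult_mem by blast
        ultimately have "s * (t * a) \<in> f n" using rad by blast
        then have "(s * t) * a \<in> f n" by (simp add: mult.assoc)
        then show ?thesis using memQ prime_complement(2)[OF pM s(1) t(1)] by blast
      qed
      have pQ: "prime_ideal ?V Q"
        unfolding prime_ideal_def r_ideal_def
      proof (intro conjI ballI impI)
        show "Q \<subseteq> ?V" using fR by (fastforce simp: memQ mem_localize[OF pM])
        show "Q \<noteq> ?V" using False V.one_mem by blast
        fix a b assume ab: "a \<in> ?V" "b \<in> ?V" "a * b \<in> Q"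
        consider "a = 0 \<or> b = 0" | "a \<noteq> 0" "b \<noteq> 0" "a / b \<in> ?V" | "a \<noteq> 0" "b \<noteq> 0" "b / a \<in> ?V"
          using val[of a b] by blast
        then show "a \<in> Q \<or> b \<in> Q"
        proof cases
          case 2
          have "a / b * (a * b) \<in> Q" by (rule submod_smult[OF sQ 2(3) ab(3)])
          then show ?thesis using sqQ[OF ab(1)] 2 by (simp add: power2_eq_square)
        next
          case 3
          have "b / a * (a * b) \<in> Q" by (rule submod_smult[OF sQ 3(3) ab(3)])
          then show ?thesis using sqQ[OF ab(2)] 3 by (simp add: power2_eq_square)
        qed (use submod_zero[OF sQ] in auto)
      qed (rule sQ)
      have "x \<in> Q" using x fQ by blast
      then obtain q where q: "q \<in> Q" "q \<noteq> 0" "\<And>b. b \<in> Q \<Longrightarrow> b \<noteq> 0 \<Longrightarrow> q / b \<notin> Q"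
        using strongly_discrete_local[OF sd M pQ _ x(2)] by blast
      obtain N s where s: "s \<in> R - M" "s * q \<in> f N" using q(1) memQ by blast
      have "f n \<subseteq> localize R M (f N)" for n
      proof
        fix y assume y: "y \<in> f n"
        show "y \<in> localize R M (f N)"
        proof (cases "y = 0")
          case True
          then show ?thesis using submod_zero[OF sf] localize_superset[OF pM] by blast
        next
          case y0: False
          have yQ: "y \<in> Q" using y fQ by blast
          \<comment> \<open>If the square of y divided q, then q would be a product of y with an
            element of Q. So q divides the square of y, and radicality puts y locally into the same
            f N as q.\<close>
          have "q / y\<^sup>2 \<notin> ?V"
          proof
            assume "q / y\<^sup>2 \<in> ?V"
            from submod_smult[OF sQ this yQ] have "q / y \<in> Q" using y0 by (simp add: power2_eq_square)
            then show False using q(3)[OF yQ y0] by blast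
          qed
          then have "y\<^sup>2 / q \<in> ?V" using val by blast
          then obtain t where t: "t \<in> R - M" "t * (y\<^sup>2 / q) \<in> R" using mem_localize[OF pM] by blast
          have "(s * t) * ((t * (y\<^sup>2 / q)) * (s * q)) \<in> f N"
            by (rule submod_smult[OF sf _ submod_smult[OF sf t(2) s(2)]])
              (use s t in \<open>auto intro: mult_mem\<close>)
          then have "(s * t * y)\<^sup>2 \<in> f N" using q(2) by (simp add: power2_eq_square ac_simps)
          moreover have "s * t * y \<in> R" using s t y fR by (intro mult_mem) auto
          ultimately have "s * t * y \<in> f N" using rad by blast
          then show ?thesis using prime_complement(2)[OF pM s(1) t(1)] by (intro localizeI[OF M]) auto
        qed
      qed
      then show ?thesis by blast
    qed
  qed
  then obtain N where N: "\<And>M n. t_max R M \<Longrightarrow> f n \<subseteq> localize R M (f (N M))" by metis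
  \<comment> \<open>The largest local index over the t-maximal ideals containing x; 0 covers the
    case that there are none.\<close>
  define k where "k = Max (insert 0 (N ` {M. t_max R M \<and> x \<in> M}))"
  have fin: "finite {M. t_max R M \<and> x \<in> M}" using fc x fR by (auto simp: t_finite_char_def)
  have "f n \<subseteq> f k" for n
  proof -
    have "f n \<subseteq> w_op R (f k)"
    proof
      fix y assume y: "y \<in> f n"
      show "y \<in> w_op R (f k)"
        unfolding mem_w_op
      proof (intro allI impI)
        fix M assume M: "t_max R M"
        show "y \<in> localize R M (f k)"
        proof (cases "x \<in> M")
          case True
          then have "N M \<le> k" unfolding k_def using fin M by (intro Max_ge) auto
          then show ?thesis using N[OF M, of n] y mono[of "N M" k] by (fastforce simp: mem_localize_t_max[OF M])
        next
          case False
          have "x \<in> f k" using x mono[of 0 k] by auto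
          then have "y * x \<in> f k" using submod_smult[OF sf] y fR by blast
          then show ?thesis using False x fR by (intro localizeI[OF M, of x]) (auto simp: mult.commute)
        qed
      qed
    qed
    then show ?thesis using t_ideal_w_ideal[OF tf[of k]] by (simp add: w_ideal_def)
  qed
  then show "\<exists>N. \<forall>n\<ge>N. f n = f N" using mono by (intro exI[of _ k]) blast
qed

lemma w_stable_PvMD_imp_strongly_discrete:
  assumes st: "w_stable_domain R" and pvmd: "PvMD R"
  shows "strongly_discrete_PvMD R" "t_finite_char R" "\<forall>M. t_max R M \<longrightarrow> t_invertible R M"
    "\<forall>P. t_prime R P \<longrightarrow> w_stable_ideal R P"
proof -
  have stI: "w_stable_ideal R I" if "t_ideal R I" "I \<subseteq> R" for I
    using st t_ideal_w_ideal that unfolding w_stable_domain_def by blast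
  show prime: "\<forall>P. t_prime R P \<longrightarrow> w_stable_ideal R P"
    using stI prime_subset by (simp add: t_prime_def)
  then show "strongly_discrete_PvMD R"
    using pvmd w_stable_prime_not_idempotent by (simp add: strongly_discrete_PvMD_def)
  show inv: "\<forall>M. t_max R M \<longrightarrow> t_invertible R M"
    using w_stable_t_max_t_invertible[OF pvmd] stI t_max_ideal by blast
  show "t_finite_char R"
    using w_stable_t_invertible_imp_t_finite_char[OF st] inv by blast
qed

end

theorem theorem2p6:
  fixes R :: "'a::field set"
  assumes "is_subring R" and "quotient_field_is_univ R" and "R \<noteq> UNIV"
  shows "(integrally_closed R \<and> w_stable_domain R \<longleftrightarrow> w_stable_domain R \<and> PvMD R)
    \<and> (w_stable_domain R \<and> PvMD R \<longleftrightarrow> strongly_discrete_PvMD R \<and> t_finite_char R)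
    \<and> (strongly_discrete_PvMD R \<and> t_finite_char R \<longleftrightarrow> gen_Krull R \<and> t_finite_char R)
    \<and> (gen_Krull R \<and> t_finite_char R \<longleftrightarrow> w_stable_domain R \<and> gen_Krull R)
    \<and> (w_stable_domain R \<and> gen_Krull R \<longleftrightarrow>
         PvMD R \<and> t_finite_char R \<and> (\<forall>P. t_prime R P \<longrightarrow> w_stable_ideal R P))
    \<and> (PvMD R \<and> t_finite_char R \<and> (\<forall>P. t_prime R P \<longrightarrow> w_stable_ideal R P) \<longleftrightarrow>
         w_stable_domain R \<and> (\<forall>M. t_max R M \<longrightarrow> t_invertible R M))"
proof -
  interpret nonfield_domain R using assms by unfold_locales
  have sd: "strongly_discrete_PvMD R \<Longrightarrow> PvMD R"
    by (simp add: strongly_discrete_PvMD_def)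
  have gk: "gen_Krull R \<longleftrightarrow> strongly_discrete_PvMD R \<and> acc_radical_t R"
    by (simp add: gen_Krull_def)
  have i: "integrally_closed R \<and> w_stable_domain R \<longleftrightarrow> w_stable_domain R \<and> PvMD R"
    using integrally_closed_w_stable_imp_PvMD PvMD_integrally_closed by blast
  have ii: "w_stable_domain R \<and> PvMD R \<longleftrightarrow> strongly_discrete_PvMD R \<and> t_finite_char R"
    using w_stable_PvMD_imp_strongly_discrete(1,2) strongly_discrete_t_finite_imp_w_stable sd by blast
  have iii: "gen_Krull R \<and> t_finite_char R \<longleftrightarrow> strongly_discrete_PvMD R \<and> t_finite_char R"
    using gk strongly_discrete_t_finite_imp_acc by blast
  have v: "w_stable_domain R \<and> gen_Krull R \<longleftrightarrow> strongly_discrete_PvMD R \<and> t_finite_char R"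
    using ii iii gk sd by blast
  \<comment> \<open>From (vi), w-stability of the t-primes already excludes t-idempotent ones; full
    w-stability returns only through (iii).\<close>
  have vi: "PvMD R \<and> t_finite_char R \<and> (\<forall>P. t_prime R P \<longrightarrow> w_stable_ideal R P) \<longleftrightarrow>
      strongly_discrete_PvMD R \<and> t_finite_char R"
    using ii w_stable_PvMD_imp_strongly_discrete(4) w_stable_prime_not_idempotent
    unfolding strongly_discrete_PvMD_def by blast
  have vii: "w_stable_domain R \<and> (\<forall>M. t_max R M \<longrightarrow> t_invertible R M) \<longleftrightarrow>
      strongly_discrete_PvMD R \<and> t_finite_char R"
    using ii w_stable_PvMD_imp_strongly_discrete(3) w_stable_t_invertible_imp_PvMD by blast
  show ?thesis unfolding i ii iii v vi vii by simp
qed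

end
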